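(* Let $\mathcal{H}$ be an infinite-dimensional complex Hilbert space and let $G=U_1(\mathcal{H})$ be endowed with a continuous $\mathbb{R}$-action $\alpha\colon\mathbb{R}\to\mathrm{Aut}(G)$ given by $\alpha_t(g)=e^{itA}ge^{-itA}$ for some bounded self-adjoint operator $A$ on $\mathcal{H}$. Assume that $A$ is diagonalisable. Then every positive energy covariant unitary representation $\pi_\lambda\colon G\rtimes_\alpha\mathbb{R}\to U(\mathcal{H}_\lambda)$ of $(G,\mathbb{R},\alpha)$ (of the form described in the context) is similar to a minimal energy representation.
   Context: $U_1(\mathcal{H})$ is the group of unitary operators $g$ on $\mathcal{H}$ with $g-\mathbf{1}$ of trace class; its Lie algebra $\mathfrak{u}_1(\mathcal{H})$ is the Banach space of skew-hermitian trace-class operators. Since $A$ is diagonalisable, choose an orthonormal basis $(e_j)_{j\in J}$ of $\mathcal{H}$ with $Ae_j=d_je_j$, $d_j\in\mathbb{R}$, so $\mathcal{H}=\ell^2(J,\mathbb{C})$. Let $\mathfrak{gl}(J,\mathbb{C})$ be the Lie algebra of $J\times J$ matrices with finitely many nonzero entries, with diagonal subalgebra having basis the matrix units $E_{jj}$; let $\epsilon_j$ be the dual functionals, and $\Delta=\{\epsilon_j-\epsilon_k : j\ne k\}$. Let $\lambda=(\lambda_j)_{j\in J}\in\mathbb{Z}^J$ be bounded. Let $V^\lambda$ be the unitary highest weight module of highest weight $\lambda$ (with respect to a positive system $\Delta_+\subseteq\Delta$ for which $\lambda$ is dominant), i.e. it is generated by a vector $v_\lambda$ of weight $\lambda$ (with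 $E_{jj}v_\lambda=\lambda_jv_\lambda$) annihilated by the root spaces of all $\alpha\in\Delta_+$, and it carries a positive definite hermitian form with $\langle X.v,w\rangle=\langle v,X^*.w\rangle$. Let $\mathcal{P}_\lambda\subseteq\lambda+\mathbb{Z}[\Delta]$ be its set of weights and $\mathcal{H}_\lambda$ the Hilbert space completion of $V^\lambda$. It is known that the representation of the skew-hermitian finite matrices on $V^\lambda$ extends to a continuous unitary representation $\mathfrak{u}_1(\mathcal{H})\to\mathfrak{u}(\mathcal{H}_\lambda)$ which exponentiates to a unitary representation $\hat\rho_\lambda\colon U_1(\mathcal{H})\to U(\mathcal{H}_\lambda)$. For a bounded self-adjoint operator $B$ which is diagonal in the basis $(e_j)$ with $Be_j=b_je_j$, let $\chi_B\colon\mathbb{Z}[\Delta]\to\mathbb{R}$ be the character induced by $\epsilon_j\mapsto b_j$, let $\alpha^B_t(g)=e^{itB}ge^{-itB}$, and define $U^B\colon\mathbb{R}\to U(\mathcal{H}_\lambda)$ by $U^B_tv_\mu=e^{it\chi_B(\mu-\lambda)}v_\mu$ for every $\mu\in\mathcal{P}_\lambda$ and every weight vector $v_\mu$ of weight $\mu$ (so $U_t^Bv_\lambda=v_\lambda$). The associated covariant unitary representation of $(G,\mathbb{R},\alpha^B)$ is $G\rtimes_{\alpha^B}\mathbb{R}\to U(\mathcal{H}_\lambda)$, $(g,t)\mapsto\hat\rho_\lambda(g)U^B_t$, and its Hamiltonian is $-i\frac{d}{dt}|_{t=0}U^B_t$. The representation $\pi_\lambda$ in the claim is the one associated with $B=A$.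 A covariant representation is of positive energy if the spectrum of its Hamiltonian is bounded from below; it is a minimal energy representation if its Hamiltonian is non-negative (with eigenvalue $0$ on $v_\lambda$). The covariant representation $\pi_\lambda$ of $G\rtimes_\alpha\mathbb{R}$ associated with $A$ is called similar to the covariant representation of $G\rtimes_{\alpha^{\min}}\mathbb{R}$ (with the same $\lambda$) associated with a bounded self-adjoint operator $A_{\min}$ diagonal in the basis $(e_j)$, where $\alpha^{\min}=\alpha^{A_{\min}}$, if $A=A_{\min}+A_{\mathrm{sum}}$ with $A_{\mathrm{sum}}$ bounded self-adjoint, diagonal in the same basis, and $iA_{\mathrm{sum}}\in\mathfrak{u}_1(\mathcal{H})$. In this case $\alpha_t$ differs from $\alpha_t^{\min}$ by the inner automorphism $g\mapsto e^{itA_{\mathrm{sum}}}ge^{-itA_{\mathrm{sum}}}$ of $G$, which commutes with $\alpha_t$ and $\alpha^{\min}_t$. *)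

theory Defs
  imports "HOL-Analysis.Analysis" "HOL-Algebra.Group"
begin

section \<open>Complex Hilbert spaces and bounded operators\<close>

text \<open>The inner product is antilinear in the first argument.\<close>

class chilbert_space = banach +
  fixes scaleC :: "complex \<Rightarrow> 'a \<Rightarrow> 'a" (infixr "*\<^sub>C" 75)
    and cinner :: "'a \<Rightarrow> 'a \<Rightarrow> complex"
  assumes scaleC_add_right: "c *\<^sub>C (x + y) = c *\<^sub>C x + c *\<^sub>C y"
    and scaleC_add_left: "(c + d) *\<^sub>C x = c *\<^sub>C x + d *\<^sub>C x"
    and scaleC_scaleC: "c *\<^sub>C d *\<^sub>C x = (c * d) *\<^sub>C x"
    and scaleC_of_real: "complex_of_real r *\<^sub>C x = r *\<^sub>R x"
    and cinner_commute: "cinner x y = cnj (cinner y x)"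
    and cinner_add_right: "cinner x (y + z) = cinner x y + cinner x z"
    and cinner_scaleC_right: "cinner x (c *\<^sub>C y) = c * cinner x y"
    and cinner_self: "cinner x x = complex_of_real ((norm x)\<^sup>2)"

definition infinite_dimensional :: "'h::chilbert_space itself \<Rightarrow> bool" where
  "infinite_dimensional _ \<longleftrightarrow> \<not> (\<exists>B :: 'h set. finite B \<and> module.span (*\<^sub>C) B = UNIV)"

definition orthonormal_basis :: "'h::chilbert_space set \<Rightarrow> bool" where
  "orthonormal_basis E \<longleftrightarrow>
     (\<forall>x\<in>E. \<forall>y\<in>E. cinner x y = of_bool (x = y)) \<and> closure (module.span (*\<^sub>C) E) = UNIV"

definition bounded_clinear :: "('a::chilbert_space \<Rightarrow> 'b::chilbert_space) \<Rightarrow> bool" where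
  "bounded_clinear T \<longleftrightarrow> bounded_linear T \<and> (\<forall>c x. T (c *\<^sub>C x) = c *\<^sub>C T x)"

definition bounded_selfadjoint :: "('h::chilbert_space \<Rightarrow> 'h) \<Rightarrow> bool" where
  "bounded_selfadjoint T \<longleftrightarrow> bounded_clinear T \<and> (\<forall>x y. cinner (T x) y = cinner x (T y))"

definition bounded_skewhermitian :: "('h::chilbert_space \<Rightarrow> 'h) \<Rightarrow> bool" where
  "bounded_skewhermitian T \<longleftrightarrow> bounded_clinear T \<and> (\<forall>x y. cinner (T x) y = - cinner x (T y))"

definition unitary_op :: "('h::chilbert_space \<Rightarrow> 'h) \<Rightarrow> bool" where
  "unitary_op u \<longleftrightarrow> bounded_clinear u \<and> surj u \<and> (\<forall>x y. cinner (u x) (u y) = cinner x y)"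

definition op_exp :: "('h::chilbert_space \<Rightarrow> 'h) \<Rightarrow> 'h \<Rightarrow> 'h" where
  "op_exp T x = (\<Sum>n. (T ^^ n) x /\<^sub>R fact n)"

definition commutator :: "('h::chilbert_space \<Rightarrow> 'h) \<Rightarrow> ('h \<Rightarrow> 'h) \<Rightarrow> 'h \<Rightarrow> 'h" where
  "commutator S T x = S (T x) - T (S x)"


section \<open>Trace class operators\<close>

text \<open>\<open>is_abs T P\<close> says that \<open>P = |T|\<close>, the unique positive operator with \<open>P\<^sup>2 = T\<^sup>*T\<close>.
  A positive operator is self-adjoint, so \<open>P\<^sup>2 = T\<^sup>*T\<close> is the last conjunct.\<close>

definition is_abs :: "('h::chilbert_space \<Rightarrow> 'h) \<Rightarrow> ('h \<Rightarrow> 'h) \<Rightarrow> bool" where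
  "is_abs T P \<longleftrightarrow> bounded_clinear P \<and> (\<forall>x. cinner x (P x) \<in> \<real>\<^sub>\<ge>\<^sub>0) \<and>
     (\<forall>x y. cinner (P x) (P y) = cinner (T x) (T y))"

definition trace_class :: "('h::chilbert_space \<Rightarrow> 'h) \<Rightarrow> bool" where
  "trace_class T \<longleftrightarrow> bounded_clinear T \<and>
     (\<exists>P. is_abs T P \<and> (\<forall>E. orthonormal_basis E \<longrightarrow> (\<lambda>x. cinner x (P x)) summable_on E))"

text \<open>The trace of \<open>|T|\<close>; only meaningful for trace class \<open>T\<close>.\<close>

definition trace_norm :: "('h::chilbert_space \<Rightarrow> 'h) \<Rightarrow> real" where
  "trace_norm T = (THE c. \<exists>P. is_abs T P \<and>
     (\<forall>E. orthonormal_basis E \<longrightarrow> ((\<lambda>x. cinner x (P x)) has_sum complex_of_real c) E))"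

definition u1 :: "('h::chilbert_space \<Rightarrow> 'h) set" where
  "u1 = {x. bounded_skewhermitian x \<and> trace_class x}"

definition unitary_group :: "('h::chilbert_space \<Rightarrow> 'h) monoid" where
  "unitary_group = \<lparr>carrier = {u. unitary_op u}, mult = (\<circ>), one = id\<rparr>"

definition U1 :: "('h::chilbert_space \<Rightarrow> 'h) monoid" where
  "U1 = \<lparr>carrier = {g. unitary_op g \<and> trace_class (\<lambda>x. g x - x)}, mult = (\<circ>), one = id\<rparr>"


section \<open>Covariant unitary representations\<close>

text \<open>The action \<open>\<alpha>\<^sub>t(g) = e\<^bsup>itA\<^esup> g e\<^bsup>-itA\<^esup>\<close>.\<close>

definition conj_action :: "('h::chilbert_space \<Rightarrow> 'h) \<Rightarrow> real \<Rightarrow> ('h \<Rightarrow> 'h) \<Rightarrow> 'h \<Rightarrow> 'h" where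
  "conj_action A t g =
     op_exp (\<lambda>x. (\<i> * of_real t) *\<^sub>C A x) \<circ> g \<circ> op_exp (\<lambda>x. (- \<i> * of_real t) *\<^sub>C A x)"

definition semidirect :: "('g, 'm) monoid_scheme \<Rightarrow> (real \<Rightarrow> 'g \<Rightarrow> 'g) \<Rightarrow> ('g \<times> real) monoid" where
  "semidirect G \<alpha> = \<lparr>carrier = carrier G \<times> UNIV,
     mult = (\<lambda>(g, s) (h, t). (g \<otimes>\<^bsub>G\<^esub> \<alpha> s h, s + t)), one = (\<one>\<^bsub>G\<^esub>, 0)\<rparr>"

text \<open>Strongly continuous unitary representations of \<open>U\<^sub>1(\<H>) \<rtimes>\<^bsub>\<alpha>\<^esub> \<real>\<close>, where \<open>U\<^sub>1(\<H>)\<close> carries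
  the topology of the trace norm distance.\<close>

definition covariant_rep ::
    "(real \<Rightarrow> ('h::chilbert_space \<Rightarrow> 'h) \<Rightarrow> 'h \<Rightarrow> 'h) \<Rightarrow>
     (('h \<Rightarrow> 'h) \<times> real \<Rightarrow> 'k::chilbert_space \<Rightarrow> 'k) \<Rightarrow> bool" where
  "covariant_rep \<alpha> \<pi> \<longleftrightarrow> group_hom (semidirect U1 \<alpha>) unitary_group \<pi> \<and>
     (\<forall>v. \<forall>g\<in>carrier U1. \<forall>t. \<forall>\<epsilon>>0. \<exists>\<delta>>0. \<forall>h\<in>carrier U1. \<forall>s.
        trace_norm (\<lambda>x. h x - g x) < \<delta> \<and> \<bar>s - t\<bar> < \<delta> \<longrightarrow> norm (\<pi> (h, s) v - \<pi> (g, t) v) < \<epsilon>)"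

text \<open>The graph of the unbounded operator \<open>-i d/dt|\<^bsub>t=0\<^esub> \<pi>(1,t)\<close>; its domain consists of all vectors
  with differentiable orbit map.\<close>

definition hamiltonian :: "(('h \<Rightarrow> 'h) \<times> real \<Rightarrow> 'k::chilbert_space \<Rightarrow> 'k) \<Rightarrow> ('k \<times> 'k) set" where
  "hamiltonian \<pi> = {(v, w). ((\<lambda>t. \<pi> (id, t) v) has_vector_derivative \<i> *\<^sub>C w) (at 0)}"

text \<open>For an unbounded operator given by its graph \<open>H\<close>, a point \<open>z\<close> is in the resolvent set iff
  \<open>H - z\<close> has an everywhere defined bounded inverse \<open>R\<close>.\<close>

definition graph_spectrum :: "('k::chilbert_space \<times> 'k) set \<Rightarrow> complex set" where
  "graph_spectrum H = {z. \<not> (\<exists>R. bounded_clinear R \<and>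
     (\<forall>(v, w)\<in>H. R (w - z *\<^sub>C v) = v) \<and> (\<forall>y. (R y, y + z *\<^sub>C R y) \<in> H))}"

definition positive_energy_rep ::
    "('h::chilbert_space \<Rightarrow> 'h) \<Rightarrow> (('h \<Rightarrow> 'h) \<times> real \<Rightarrow> 'k::chilbert_space \<Rightarrow> 'k) \<Rightarrow> bool" where
  "positive_energy_rep A \<pi> \<longleftrightarrow> covariant_rep (conj_action A) \<pi> \<and>
     (\<exists>m. \<forall>z\<in>graph_spectrum (hamiltonian \<pi>). m \<le> Re z)"

definition minimal_energy_rep ::
    "('h::chilbert_space \<Rightarrow> 'h) \<Rightarrow> 'k::chilbert_space \<Rightarrow>
     (('h \<Rightarrow> 'h) \<times> real \<Rightarrow> 'k \<Rightarrow> 'k) \<Rightarrow> bool" where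
  "minimal_energy_rep A v\<^sub>0 \<pi> \<longleftrightarrow> covariant_rep (conj_action A) \<pi> \<and>
     (\<forall>(v, w)\<in>hamiltonian \<pi>. cinner v w \<in> \<real>\<^sub>\<ge>\<^sub>0) \<and> (v\<^sub>0, 0) \<in> hamiltonian \<pi>"


section \<open>Unitary highest weight modules of \<open>\<gg>\<ll>(J,\<complex>)\<close>\<close>

text \<open>The index set \<open>J\<close> is the type \<open>'j\<close>.\<close>

definition gl :: "('j \<Rightarrow> 'j \<Rightarrow> complex) set" where
  "gl = {X. finite {(j, k). X j k \<noteq> 0}}"

definition matrix_unit :: "'j \<Rightarrow> 'j \<Rightarrow> 'j \<Rightarrow> 'j \<Rightarrow> complex" where
  "matrix_unit j k = (\<lambda>i l. of_bool (i = j \<and> l = k))"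

definition mat_mult :: "('j \<Rightarrow> 'j \<Rightarrow> complex) \<Rightarrow> ('j \<Rightarrow> 'j \<Rightarrow> complex) \<Rightarrow> 'j \<Rightarrow> 'j \<Rightarrow> complex" where
  "mat_mult X Y = (\<lambda>i k. \<Sum>j | X i j \<noteq> 0. X i j * Y j k)"

definition mat_bracket :: "('j \<Rightarrow> 'j \<Rightarrow> complex) \<Rightarrow> ('j \<Rightarrow> 'j \<Rightarrow> complex) \<Rightarrow> 'j \<Rightarrow> 'j \<Rightarrow> complex" where
  "mat_bracket X Y = (\<lambda>i k. mat_mult X Y i k - mat_mult Y X i k)"

definition mat_adj :: "('j \<Rightarrow> 'j \<Rightarrow> complex) \<Rightarrow> 'j \<Rightarrow> 'j \<Rightarrow> complex" where
  "mat_adj X = (\<lambda>j k. cnj (X k j))"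

text \<open>Integral functionals on the diagonal subalgebra are identified with functions
  \<open>\<mu> :: 'j \<Rightarrow> int\<close>, where \<open>\<mu> j\<close> is the value on \<open>E\<^sub>j\<^sub>j\<close>. Thus \<open>root j k\<close> is \<open>\<epsilon>\<^sub>j - \<epsilon>\<^sub>k\<close>; its root
  space is spanned by \<open>E\<^sub>j\<^sub>k\<close>.\<close>

definition root :: "'j \<Rightarrow> 'j \<Rightarrow> 'j \<Rightarrow> int" where
  "root j k = (\<lambda>i. of_bool (i = j) - of_bool (i = k))"

definition roots :: "('j \<Rightarrow> int) set" where
  "roots = {root j k | j k. j \<noteq> k}"

definition positive_system :: "('j \<Rightarrow> int) set \<Rightarrow> bool" where
  "positive_system P \<longleftrightarrow> P \<union> (\<lambda>\<alpha> i. - \<alpha> i) ` P = roots \<and> P \<inter> (\<lambda>\<alpha> i. - \<alpha> i) ` P = {} \<and>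
     (\<forall>\<alpha>\<in>P. \<forall>\<beta>\<in>P. (\<lambda>i. \<alpha> i + \<beta> i) \<in> roots \<longrightarrow> (\<lambda>i. \<alpha> i + \<beta> i) \<in> P)"

text \<open>A unitary highest weight module \<open>V\<close> of highest weight \<open>\<lambda>\<close>, realised as a subspace of a
  Hilbert space. Its positive definite contravariant form is the restriction of the inner product.\<close>

locale unitary_highest_weight_module =
  fixes lam :: "'j \<Rightarrow> int"
    and pos :: "('j \<Rightarrow> int) set"
    and V :: "'k::chilbert_space set"
    and act :: "('j \<Rightarrow> 'j \<Rightarrow> complex) \<Rightarrow> 'k \<Rightarrow> 'k"
    and v\<^sub>0 :: 'k
  assumes pos: "positive_system pos"
    and dominant: "\<And>j k. root j k \<in> pos \<Longrightarrow> lam k \<le> lam j"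
    and subspace: "module.subspace (*\<^sub>C) V"
    and act_closed: "\<And>X v. X \<in> gl \<Longrightarrow> v \<in> V \<Longrightarrow> act X v \<in> V"
    and act_add: "\<And>X v w. X \<in> gl \<Longrightarrow> v \<in> V \<Longrightarrow> w \<in> V \<Longrightarrow> act X (v + w) = act X v + act X w"
    and act_scale: "\<And>X c v. X \<in> gl \<Longrightarrow> v \<in> V \<Longrightarrow> act X (c *\<^sub>C v) = c *\<^sub>C act X v"
    and add_act: "\<And>X Y v. X \<in> gl \<Longrightarrow> Y \<in> gl \<Longrightarrow> v \<in> V \<Longrightarrow>
          act (\<lambda>j k. X j k + Y j k) v = act X v + act Y v"
    and scale_act: "\<And>X c v. X \<in> gl \<Longrightarrow> v \<in> V \<Longrightarrow> act (\<lambda>j k. c * X j k) v = c *\<^sub>C act X v"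
    and act_bracket: "\<And>X Y v. X \<in> gl \<Longrightarrow> Y \<in> gl \<Longrightarrow> v \<in> V \<Longrightarrow>
          act (mat_bracket X Y) v = act X (act Y v) - act Y (act X v)"
    and contravariant: "\<And>X v w. X \<in> gl \<Longrightarrow> v \<in> V \<Longrightarrow> w \<in> V \<Longrightarrow>
          cinner (act X v) w = cinner v (act (mat_adj X) w)"
    and hw_mem: "v\<^sub>0 \<in> V"
    and hw_nonzero: "v\<^sub>0 \<noteq> 0"
    and hw_weight: "\<And>j. act (matrix_unit j j) v\<^sub>0 = of_int (lam j) *\<^sub>C v\<^sub>0"
    and hw_annihilated: "\<And>j k. root j k \<in> pos \<Longrightarrow> act (matrix_unit j k) v\<^sub>0 = 0"
    and generated: "\<And>W. module.subspace (*\<^sub>C) W \<Longrightarrow> W \<subseteq> V \<Longrightarrow> v\<^sub>0 \<in> W \<Longrightarrow>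
          (\<And>X w. X \<in> gl \<Longrightarrow> w \<in> W \<Longrightarrow> act X w \<in> W) \<Longrightarrow> W = V"

definition weight_space ::
    "'k::chilbert_space set \<Rightarrow> (('j \<Rightarrow> 'j \<Rightarrow> complex) \<Rightarrow> 'k \<Rightarrow> 'k) \<Rightarrow> ('j \<Rightarrow> int) \<Rightarrow> 'k set" where
  "weight_space V act \<mu> = {v \<in> V. \<forall>j. act (matrix_unit j j) v = of_int (\<mu> j) *\<^sub>C v}"

definition weights ::
    "'k::chilbert_space set \<Rightarrow> (('j \<Rightarrow> 'j \<Rightarrow> complex) \<Rightarrow> 'k \<Rightarrow> 'k) \<Rightarrow> ('j \<Rightarrow> int) set" where
  "weights V act = {\<mu>. \<exists>v\<in>weight_space V act \<mu>. v \<noteq> 0}"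


section \<open>The representations of \<open>U\<^sub>1(\<H>)\<close> and of the semidirect products\<close>

text \<open>The finite rank operator with matrix \<open>X\<close> in the basis \<open>e\<close>.\<close>

definition mat_op :: "('j \<Rightarrow> 'h::chilbert_space) \<Rightarrow> ('j \<Rightarrow> 'j \<Rightarrow> complex) \<Rightarrow> 'h \<Rightarrow> 'h" where
  "mat_op e X x = (\<Sum>(j, k) | X j k \<noteq> 0. (X j k * cinner (e k) x) *\<^sub>C e j)"

text \<open>\<open>d\<rho>\<close> is the continuous extension to \<open>u1\<close> (with the trace norm) of the representation of the
  skew-hermitian finite matrices on \<open>V\<close>, and \<open>\<rho>\<close> is the unitary representation of \<open>U1\<close> which
  integrates it. As \<open>V\<close> is dense and \<open>U1 = exp u1\<close>, both are determined by \<open>e\<close>, \<open>V\<close> and \<open>act\<close>.\<close>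

locale integrated_rep =
  fixes e :: "'j \<Rightarrow> 'h::chilbert_space"
    and V :: "'k::chilbert_space set"
    and act :: "('j \<Rightarrow> 'j \<Rightarrow> complex) \<Rightarrow> 'k \<Rightarrow> 'k"
    and d\<rho> :: "('h \<Rightarrow> 'h) \<Rightarrow> 'k \<Rightarrow> 'k"
    and \<rho> :: "('h \<Rightarrow> 'h) \<Rightarrow> 'k \<Rightarrow> 'k"
  assumes derived_skew: "\<And>x. x \<in> u1 \<Longrightarrow> bounded_skewhermitian (d\<rho> x)"
    and derived_add: "\<And>x y v. x \<in> u1 \<Longrightarrow> y \<in> u1 \<Longrightarrow> d\<rho> (\<lambda>z. x z + y z) v = d\<rho> x v + d\<rho> y v"
    and derived_scaleR: "\<And>x r v. x \<in> u1 \<Longrightarrow> d\<rho> (\<lambda>z. r *\<^sub>R x z) v = r *\<^sub>R d\<rho> x v"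
    and derived_bracket: "\<And>x y. x \<in> u1 \<Longrightarrow> y \<in> u1 \<Longrightarrow>
          d\<rho> (commutator x y) = commutator (d\<rho> x) (d\<rho> y)"
    and derived_continuous: "\<exists>C. \<forall>x\<in>u1. onorm (d\<rho> x) \<le> C * trace_norm x"
    and derived_extends: "\<And>X v. X \<in> gl \<Longrightarrow> mat_adj X = (\<lambda>j k. - X j k) \<Longrightarrow> v \<in> V \<Longrightarrow>
          d\<rho> (mat_op e X) v = act X v"
    and rep: "group_hom U1 unitary_group \<rho>"
    and exponentiates: "\<And>x. x \<in> u1 \<Longrightarrow> \<rho> (op_exp x) = op_exp (d\<rho> x)"

definition diagonal_in :: "('j \<Rightarrow> 'h::chilbert_space) \<Rightarrow> ('h \<Rightarrow> 'h) \<Rightarrow> bool" where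
  "diagonal_in e B \<longleftrightarrow> (\<exists>b. \<forall>j. B (e j) = complex_of_real (b j) *\<^sub>C e j)"

definition diag_entry :: "('j \<Rightarrow> 'h::chilbert_space) \<Rightarrow> ('h \<Rightarrow> 'h) \<Rightarrow> 'j \<Rightarrow> real" where
  "diag_entry e B j = Re (cinner (e j) (B (e j)))"

text \<open>The character \<open>\<chi>\<^sub>B\<close>. It is applied to finitely supported \<open>\<gamma>\<close> only, as the elements of
  \<open>\<int>[\<Delta>]\<close> are.\<close>

definition character :: "('j \<Rightarrow> 'h::chilbert_space) \<Rightarrow> ('h \<Rightarrow> 'h) \<Rightarrow> ('j \<Rightarrow> int) \<Rightarrow> real" where
  "character e B \<gamma> = (\<Sum>j | \<gamma> j \<noteq> 0. of_int (\<gamma> j) * diag_entry e B j)"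

text \<open>\<open>U\<close> is the unitary one-parameter group \<open>U\<^sup>B\<close>. It is unique, as weight vectors span the dense
  subspace \<open>V\<close>.\<close>

definition is_weight_flow ::
    "('j \<Rightarrow> 'h::chilbert_space) \<Rightarrow> ('j \<Rightarrow> int) \<Rightarrow> 'k::chilbert_space set \<Rightarrow>
     (('j \<Rightarrow> 'j \<Rightarrow> complex) \<Rightarrow> 'k \<Rightarrow> 'k) \<Rightarrow> ('h \<Rightarrow> 'h) \<Rightarrow> (real \<Rightarrow> 'k \<Rightarrow> 'k) \<Rightarrow> bool" where
  "is_weight_flow e lam V act B U \<longleftrightarrow> (\<forall>t. unitary_op (U t)) \<and>
     (\<forall>\<mu>\<in>weights V act. \<forall>v\<in>weight_space V act \<mu>. \<forall>t.
        U t v = cis (t * character e B (\<lambda>j. \<mu> j - lam j)) *\<^sub>C v)"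

definition associated_rep ::
    "('j \<Rightarrow> 'h::chilbert_space) \<Rightarrow> ('j \<Rightarrow> int) \<Rightarrow> 'k::chilbert_space set \<Rightarrow>
     (('j \<Rightarrow> 'j \<Rightarrow> complex) \<Rightarrow> 'k \<Rightarrow> 'k) \<Rightarrow> (('h \<Rightarrow> 'h) \<Rightarrow> 'k \<Rightarrow> 'k) \<Rightarrow>
     ('h \<Rightarrow> 'h) \<Rightarrow> (('h \<Rightarrow> 'h) \<times> real \<Rightarrow> 'k \<Rightarrow> 'k) \<Rightarrow> bool" where
  "associated_rep e lam V act \<rho> B \<pi> \<longleftrightarrow> bounded_selfadjoint B \<and> diagonal_in e B \<and>
     (\<exists>U. is_weight_flow e lam V act B U \<and> (\<forall>g\<in>carrier U1. \<forall>t. \<pi> (g, t) = \<rho> g \<circ> U t))"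

definition similar_reps ::
    "('j \<Rightarrow> 'h::chilbert_space) \<Rightarrow> ('j \<Rightarrow> int) \<Rightarrow> 'k::chilbert_space set \<Rightarrow>
     (('j \<Rightarrow> 'j \<Rightarrow> complex) \<Rightarrow> 'k \<Rightarrow> 'k) \<Rightarrow> (('h \<Rightarrow> 'h) \<Rightarrow> 'k \<Rightarrow> 'k) \<Rightarrow>
     ('h \<Rightarrow> 'h) \<Rightarrow> (('h \<Rightarrow> 'h) \<times> real \<Rightarrow> 'k \<Rightarrow> 'k) \<Rightarrow>
     ('h \<Rightarrow> 'h) \<Rightarrow> (('h \<Rightarrow> 'h) \<times> real \<Rightarrow> 'k \<Rightarrow> 'k) \<Rightarrow> bool" where
  "similar_reps e lam V act \<rho> A \<pi> A' \<pi>' \<longleftrightarrow>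
     associated_rep e lam V act \<rho> A \<pi> \<and> associated_rep e lam V act \<rho> A' \<pi>' \<and>
     (\<exists>S. bounded_selfadjoint S \<and> diagonal_in e S \<and> (\<lambda>x. \<i> *\<^sub>C S x) \<in> u1 \<and>
        A = (\<lambda>x. A' x + S x))"

end

theory Submission
  imports Defs
begin

text \<open>
  If \<open>F\<close> and \<open>G\<close> are finite sets of the same size with \<open>lam < lam\<close> from \<open>F\<close> to \<open>G\<close>, then moving one unit
  from each index in \<open>G\<close> to one in \<open>F\<close> leads from \<open>lam\<close> to another weight. Hence a lower bound \<open>m\<close> of the
  energy gives \<open>\<Sum>\<^sub>G d - \<Sum>\<^sub>F d \<le> - m\<close> for the entries \<open>d\<close> of \<open>A\<close>. This forces, for every level \<open>n\<close> of \<open>lam\<close>, a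
  threshold that \<open>d\<close> exceeds only by a summable amount on \<open>lam > n\<close> and falls short of only by a
  summable amount on \<open>lam \<le> n\<close>. As \<open>lam\<close>
  has finitely many values, clamping \<open>d\<close> between consecutive thresholds changes it by a summable
  family \<open>s\<close> and makes it antitone in \<open>lam\<close>. All weights lie in \<open>lam\<close> plus the cone generated by the
  \<open>\<epsilon>\<^sub>k - \<epsilon>\<^sub>j\<close> with \<open>lam k < lam j\<close>, so the clamped operator has non-negative energy. The difference \<open>S\<close>
  is trace class, and \<open>cis(t \<Sum> lam s) \<rho>(exp(-itS)) U\<^sub>t\<close> is the one-parameter group for \<open>A - S\<close>.
\<close>

section \<open>Hilbert space preliminaries\<close>

text \<open>The bound \<open>- m\<close> in the exchange inequality does not depend on the size of
  the exchanged sets. This uniformity is what makes the correction summable and not merely bounded.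
  The thresholds of different levels arise independently and need not be ordered, so running maxima
  replace them before clamping.

  Three obstacles shape the operator side. The trace class condition quantifies over all orthonormal
  bases, while the correction is diagonal in one of them. Trace norm continuity of
  \<open>\<rho>\<close> on the group is not part of \<open>integrated_rep\<close>; it is recovered
  from the given \<open>\<pi>\<close> at time 0, and so are the invariance of \<open>U1\<close>
  under the action and the relation intertwining \<open>\<rho>\<close> with \<open>U\<close>.
  Finally, minimal energy concerns every vector with differentiable orbit, and such a vector need
  not lie in \<open>V\<close>, where the weights decide the sign.\<close>

interpretation complex_vector: vector_space "(*\<^sub>C) :: complex \<Rightarrow> 'a::chilbert_space \<Rightarrow> 'a"
proof
  show "1 *\<^sub>C x = x" for x :: 'a
    using scaleC_of_real[of 1 x] by simp
qed (simp_all add: scaleC_add_left scaleC_add_right scaleC_scaleC)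

lemma scaleC_scaleR: "c *\<^sub>C (r *\<^sub>R x) = r *\<^sub>R (c *\<^sub>C x)" for x :: "'a::chilbert_space"
  by (simp add: mult.commute flip: scaleC_of_real)

lemma cinner_add_left: "cinner (x + y) z = cinner x z + cinner y z"
  for x :: "'a::chilbert_space"
  by (metis cinner_commute cinner_add_right complex_cnj_add)

lemma cinner_scaleC_left: "cinner (c *\<^sub>C x) y = cnj c * cinner x y"
  for x :: "'a::chilbert_space"
  by (metis cinner_commute cinner_scaleC_right complex_cnj_mult)

lemma cinner_scaleR_right: "cinner x (r *\<^sub>R y) = r *\<^sub>R cinner x y"
  for x :: "'a::chilbert_space"
  by (metis cinner_scaleC_right scaleC_of_real scaleR_conv_of_real)

lemma cinner_scaleR_left: "cinner (r *\<^sub>R x) y = r *\<^sub>R cinner x y"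
  for x :: "'a::chilbert_space"
  by (metis cinner_scaleC_left scaleC_of_real scaleR_conv_of_real complex_cnj_complex_of_real)

lemma cinner_zero [simp]: "cinner 0 x = 0" "cinner x 0 = 0" for x :: "'a::chilbert_space"
  using cinner_scaleR_left[of 0 x x] cinner_scaleR_right[of x 0 x] by simp_all

lemma cinner_minus_left: "cinner (- x) y = - cinner x y" for x :: "'a::chilbert_space"
  using cinner_scaleR_left[of "-1" x y] by simp

lemma cinner_minus_right: "cinner x (- y) = - cinner x y" for x :: "'a::chilbert_space"
  using cinner_scaleR_right[of x "-1" y] by simp

lemma cinner_diff_left: "cinner (x - y) z = cinner x z - cinner y z"
  for x :: "'a::chilbert_space"
  using cinner_add_left[of x "- y" z] by (simp add: cinner_minus_left)

lemma cinner_diff_right: "cinner z (x - y) = cinner z x - cinner z y"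
  for x :: "'a::chilbert_space"
  using cinner_add_right[of z x "- y"] by (simp add: cinner_minus_right)

lemma cinner_sum_left: "cinner (sum f A) y = (\<Sum>i\<in>A. cinner (f i) y)"
  for y :: "'a::chilbert_space"
  by (induction A rule: infinite_finite_induct) (simp_all add: cinner_add_left)

lemma cinner_sum_right: "cinner y (sum f A) = (\<Sum>i\<in>A. cinner y (f i))"
  for y :: "'a::chilbert_space"
  by (induction A rule: infinite_finite_induct) (simp_all add: cinner_add_right)

lemma Re_cinner_self: "Re (cinner x x) = (norm x)\<^sup>2" for x :: "'a::chilbert_space"
  by (simp add: cinner_self)

lemma cinner_eq_zero_iff: "cinner x x = 0 \<longleftrightarrow> x = 0" for x :: "'a::chilbert_space"
  by (simp add: cinner_self)

lemma norm_scaleC: "norm (c *\<^sub>C x) = cmod c * norm x" for x :: "'a::chilbert_space"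
proof -
  have "complex_of_real ((norm (c *\<^sub>C x))\<^sup>2) = (cnj c * c) * cinner x x"
    by (simp add: cinner_scaleC_left cinner_scaleC_right flip: cinner_self del: of_real_power)
  also have "\<dots> = complex_of_real ((cmod c * norm x)\<^sup>2)"
    by (simp add: cinner_self power_mult_distrib mult.commute flip: complex_norm_square)
  finally have "(norm (c *\<^sub>C x))\<^sup>2 = (cmod c * norm x)\<^sup>2"
    using of_real_eq_iff by blast
  then show ?thesis
    by (simp add: power2_eq_iff_nonneg)
qed

lemma norm_diff_squared: "(norm (x - y))\<^sup>2 = (norm x)\<^sup>2 + (norm y)\<^sup>2 - 2 * Re (cinner x y)"
  for x :: "'a::chilbert_space"
proof -
  have "Re (cinner y x) = Re (cinner x y)"
    by (subst cinner_commute) simp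
  then have "Re (cinner (x - y) (x - y)) = Re (cinner x x) + Re (cinner y y) - 2 * Re (cinner x y)"
    by (simp add: cinner_diff_left cinner_diff_right)
  then show ?thesis
    by (simp add: Re_cinner_self)
qed

lemma norm_cinner_le: "cmod (cinner x y) \<le> norm x * norm y" for x :: "'a::chilbert_space"
proof (cases "x = 0")
  case False
  \<comment> \<open>\<open>c *\<^sub>C x\<close> is the orthogonal projection of \<open>y\<close>
    onto the line through \<open>x\<close>; its distance to \<open>y\<close> being non-negative is
    the claim.\<close>
  define c where "c = cinner x y / (norm x)\<^sup>2"
  have "Re (cinner (c *\<^sub>C x) y) = (cmod (cinner x y))\<^sup>2 / (norm x)\<^sup>2"
    by (simp add: c_def cinner_scaleC_left Re_divide_of_real complex_norm_square[symmetric]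
        mult.commute[of "cnj _"])
  moreover have "(norm (c *\<^sub>C x))\<^sup>2 = (cmod (cinner x y))\<^sup>2 / (norm x)\<^sup>2"
    using False by (simp add: norm_scaleC c_def norm_divide power_mult_distrib power_divide
        norm_power) (simp add: power2_eq_square power4_eq_xxxx)
  moreover have "0 \<le> (norm (c *\<^sub>C x - y))\<^sup>2"
    by simp
  ultimately have "(cmod (cinner x y))\<^sup>2 / (norm x)\<^sup>2 \<le> (norm y)\<^sup>2"
    unfolding norm_diff_squared by simp
  then have "(cmod (cinner x y))\<^sup>2 \<le> (norm x * norm y)\<^sup>2"
    using False by (simp add: divide_le_eq power_mult_distrib mult.commute)
  then show ?thesis
    by (rule power2_le_imp_le) simp
qed simp

lemma bounded_bilinear_cinner: "bounded_bilinear (cinner :: 'a::chilbert_space \<Rightarrow> 'a \<Rightarrow> complex)"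
  by (standard, simp_all add: cinner_add_left cinner_add_right cinner_scaleR_left
      cinner_scaleR_right) (use norm_cinner_le in \<open>auto intro!: exI[of _ 1]\<close>)

lemmas bounded_linear_cinner_right = bounded_bilinear.bounded_linear_right[OF bounded_bilinear_cinner]
  and bounded_linear_cinner_left = bounded_bilinear.bounded_linear_left[OF bounded_bilinear_cinner]

lemma bounded_linear_scaleC_right: "bounded_linear (\<lambda>x :: 'a::chilbert_space. c *\<^sub>C x)"
  by (rule bounded_linear_intro[of _ "cmod c"])
    (simp_all add: scaleC_add_right scaleC_scaleR norm_scaleC mult.commute)

lemma bounded_linear_scaleC_left: "bounded_linear (\<lambda>c. c *\<^sub>C (x :: 'a::chilbert_space))"
proof (rule bounded_linear_intro[of _ "norm x"])
  show "(r *\<^sub>R c) *\<^sub>C x = r *\<^sub>R (c *\<^sub>C x)" for r c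
    by (metis scaleC_of_real scaleC_scaleC scaleR_conv_of_real)
qed (simp_all add: scaleC_add_left norm_scaleC)

lemma bounded_clinearD:
  assumes "bounded_clinear T"
  shows "bounded_linear T" "T (c *\<^sub>C x) = c *\<^sub>C T x" "T (x + y) = T x + T y" "T 0 = 0"
    "T (x - y) = T x - T y"
  using assms by (auto simp: bounded_clinear_def linear_simps)

lemma bounded_clinear_intro:
  assumes "\<And>x y. T (x + y) = T x + T y" "\<And>c x. T (c *\<^sub>C x) = c *\<^sub>C T x"
    "\<And>x. norm (T x) \<le> norm x * K"
  shows "bounded_clinear T"
  unfolding bounded_clinear_def
proof (intro conjI allI)
  have "T (r *\<^sub>R x) = r *\<^sub>R T x" for r x
    by (simp add: assms(2) flip: scaleC_of_real)
  then show "bounded_linear T"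
    using assms by (intro bounded_linear_intro) auto
qed (rule assms)

lemma bounded_clinear_compose:
  "bounded_clinear S \<Longrightarrow> bounded_clinear T \<Longrightarrow> bounded_clinear (\<lambda>x. S (T x))"
  by (auto simp: bounded_clinear_def bounded_linear_compose)

lemma bounded_clinear_add:
  "bounded_clinear S \<Longrightarrow> bounded_clinear T \<Longrightarrow> bounded_clinear (\<lambda>x. S x + T x)"
  by (auto simp: bounded_clinear_def bounded_linear_add scaleC_add_right)

lemma bounded_clinear_sub:
  "bounded_clinear S \<Longrightarrow> bounded_clinear T \<Longrightarrow> bounded_clinear (\<lambda>x. S x - T x)"
  by (auto simp: bounded_clinear_def bounded_linear_sub complex_vector.scale_right_diff_distrib)

lemma bounded_clinear_scaleC:
  "bounded_clinear T \<Longrightarrow> bounded_clinear (\<lambda>x. c *\<^sub>C T x)"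
  by (auto simp: bounded_clinear_def bounded_linear_compose[OF bounded_linear_scaleC_right]
      scaleC_scaleC mult.commute)

lemma bounded_clinear_id: "bounded_clinear (\<lambda>x. x)"
  by (simp add: bounded_clinear_def bounded_linear_ident)

lemma closed_bounded_linear_eq:
  "bounded_linear f \<Longrightarrow> bounded_linear g \<Longrightarrow> closed {x. f x = g x}"
  by (intro closed_Collect_eq linear_continuous_on)

text \<open>Bounded operators are compared on a basis throughout: linearity carries an identity to
  the span, closedness from there to the whole space.\<close>

lemma dense_span_induct:
  assumes "closure (module.span (*\<^sub>C) E) = (UNIV :: 'a::chilbert_space set)"
    and "closed {x. P x}" "P 0" "\<And>x y. P x \<Longrightarrow> P y \<Longrightarrow> P (x + y)"
    and "\<And>c x. P x \<Longrightarrow> P (c *\<^sub>C x)" "\<And>x. x \<in> E \<Longrightarrow> P x"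
  shows "P x"
proof -
  have "complex_vector.span E \<subseteq> {x. P x}"
    by (rule complex_vector.span_minimal)
      (auto intro: assms complex_vector.subspaceI)
  then have "closure (complex_vector.span E) \<subseteq> {x. P x}"
    by (intro closure_minimal assms)
  then show ?thesis
    using assms(1) by auto
qed

lemma bounded_clinear_eqI:
  assumes "closure (module.span (*\<^sub>C) E) = (UNIV :: 'a::chilbert_space set)"
    and "bounded_clinear S" "bounded_clinear T" "\<And>x. x \<in> E \<Longrightarrow> S x = T x"
  shows "S = T"
proof
  fix x
  show "S x = T x"
    by (rule dense_span_induct[OF assms(1)])
      (use assms in \<open>auto simp: bounded_clinearD intro!: closed_bounded_linear_eq\<close>)
qed

section \<open>Bessel's inequality and Parseval's identity\<close>

lemma norm_diff_finite_projection:
  assumes E: "\<forall>x\<in>E. \<forall>y\<in>E. cinner x y = of_bool (x = y)"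
    and F: "finite F" "F \<subseteq> E" and z: "z \<in> module.span (*\<^sub>C) F"
  shows "0 \<le> (norm y)\<^sup>2 - (\<Sum>x\<in>F. (cmod (cinner x y))\<^sup>2)"
    and "(norm y)\<^sup>2 - (\<Sum>x\<in>F. (cmod (cinner x y))\<^sup>2) \<le> (norm (y - z))\<^sup>2"
proof -
  obtain a where a: "z = (\<Sum>x\<in>F. a x *\<^sub>C x)"
    using z F(1) by (auto simp: complex_vector.span_finite)
  \<comment> \<open>The squared distance to a combination of \<open>F\<close> is the Bessel defect
    of \<open>y\<close> plus the squared errors of the coefficients. The Fourier coefficients make
    the errors vanish, so the defect is itself a squared distance and the smallest one.\<close>
  have *: "(norm (y - (\<Sum>x\<in>F. b x *\<^sub>C x)))\<^sup>2 = (norm y)\<^sup>2 - (\<Sum>x\<in>F. (cmod (cinner x y))\<^sup>2)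
      + (\<Sum>x\<in>F. (cmod (b x - cinner x y))\<^sup>2)" for b
  proof -
    let ?s = "\<Sum>x\<in>F. b x *\<^sub>C x"
    have "cinner ?s ?s = (\<Sum>x\<in>F. \<Sum>x'\<in>F. cnj (b x) * b x' * cinner x x')"
      unfolding cinner_sum_left cinner_sum_right cinner_scaleC_left cinner_scaleC_right
      by (subst sum.swap, simp add: mult_ac sum_distrib_left)
    also have "\<dots> = (\<Sum>x\<in>F. \<Sum>x'\<in>F. if x = x' then cnj (b x) * b x' else 0)"
    proof (intro sum.cong refl)
      fix x x'
      assume "x \<in> F" "x' \<in> F"
      then have "cinner x x' = of_bool (x = x')"
        using E F(2) by blast
      then show "cnj (b x) * b x' * cinner x x' = (if x = x' then cnj (b x) * b x' else 0)"
        by simp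
    qed
    also have "\<dots> = (\<Sum>x\<in>F. complex_of_real ((cmod (b x))\<^sup>2))"
      using F(1) by (simp add: complex_norm_square mult.commute del: of_real_power)
    finally have 1: "(norm ?s)\<^sup>2 = (\<Sum>x\<in>F. (cmod (b x))\<^sup>2)"
      by (metis Re_cinner_self Re_complex_of_real of_real_sum)
    have "cinner y ?s = (\<Sum>x\<in>F. b x * cnj (cinner x y))"
      by (simp add: cinner_sum_right cinner_scaleC_right flip: cinner_commute)
    then have 2: "Re (cinner y ?s) = (\<Sum>x\<in>F. Re (b x * cnj (cinner x y)))"
      by simp
    have "(cmod (b x - cinner x y))\<^sup>2
        = (cmod (b x))\<^sup>2 + (cmod (cinner x y))\<^sup>2 - 2 * Re (b x * cnj (cinner x y))" for x
      unfolding cmod_power2 by (simp add: power2_eq_square algebra_simps)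
    then show ?thesis
      by (simp add: norm_diff_squared 1 2 sum_subtractf sum.distrib sum_distrib_left)
  qed
  show "(norm y)\<^sup>2 - (\<Sum>x\<in>F. (cmod (cinner x y))\<^sup>2) \<le> (norm (y - z))\<^sup>2"
    unfolding a * by (simp add: sum_nonneg)
  show "0 \<le> (norm y)\<^sup>2 - (\<Sum>x\<in>F. (cmod (cinner x y))\<^sup>2)"
    using *[of "\<lambda>x. cinner x y"] by (metis (no_types, lifting) add_0_right cancel_comm_monoid_add_class.diff_cancel norm_zero power_zero_numeral sum.neutral zero_le_power2 zero_less_numeral)
qed

text \<open>Density provides a finite \<open>F\<close> whose span comes close to \<open>y\<close>.
  Every larger finite set contains the same approximant in its span, so its Bessel defect is just as
  small.\<close>

lemma parseval:
  assumes "orthonormal_basis (E :: 'a::chilbert_space set)"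
  shows "((\<lambda>x. (cmod (cinner x y))\<^sup>2) has_sum (norm y)\<^sup>2) E"
  unfolding has_sum_def tendsto_iff eventually_finite_subsets_at_top
proof (intro allI impI)
  have E: "\<forall>x\<in>E. \<forall>y\<in>E. cinner x y = of_bool (x = y)"
    and dense: "closure (complex_vector.span E) = UNIV"
    using assms by (auto simp: orthonormal_basis_def)
  fix \<epsilon> :: real
  assume "\<epsilon> > 0"
  then obtain z where z: "z \<in> complex_vector.span E" "norm (y - z) < sqrt \<epsilon>"
    using dense closure_approachable[of y "complex_vector.span E"]
    by (metis UNIV_I dist_commute dist_norm real_sqrt_gt_zero)
  obtain F where F: "finite F" "F \<subseteq> E" "z \<in> complex_vector.span F"
    using z(1) unfolding complex_vector.span_explicit
    by (smt (verit) mem_Collect_eq order_refl)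
  show "\<exists>X. finite X \<and> X \<subseteq> E \<and> (\<forall>Y. finite Y \<and> X \<subseteq> Y \<and> Y \<subseteq> E \<longrightarrow>
      dist (\<Sum>x\<in>Y. (cmod (cinner x y))\<^sup>2) ((norm y)\<^sup>2) < \<epsilon>)"
  proof (intro exI[of _ F] conjI allI impI F(1,2))
    fix Y
    assume Y: "finite Y \<and> F \<subseteq> Y \<and> Y \<subseteq> E"
    then have "z \<in> complex_vector.span Y"
      using F(3) complex_vector.span_mono by blast
    note * = norm_diff_finite_projection[OF E _ _ this, of y]
    have "(norm (y - z))\<^sup>2 < \<epsilon>"
      using z(2) \<open>\<epsilon> > 0\<close> by (metis norm_ge_zero power2_eq_iff_nonneg power_strict_mono
          real_sqrt_pow2 less_imp_le zero_less_numeral)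
    with * Y show "dist (\<Sum>x\<in>Y. (cmod (cinner x y))\<^sup>2) ((norm y)\<^sup>2) < \<epsilon>"
      by (auto simp: dist_real_def)
  qed
qed

section \<open>Diagonal trace class operators\<close>

no_notation Infinite_Set_Sum.abs_summable_on (infix "abs'_summable'_on" 50)

text \<open>Polarisation: reality of the quadratic form at \<open>x + y\<close> settles the
  imaginary part, at \<open>x + \<i> *\<^sub>C y\<close> the real part. \<open>is_abs\<close>
  records positivity only, so symmetry has to be derived.\<close>

lemma is_abs_symmetric:
  assumes "bounded_clinear P" and pos: "\<And>x. cinner x (P x) \<in> \<real>\<^sub>\<ge>\<^sub>0"
  shows "cinner (P x) y = cinner x (P y)"
proof -
  note P = bounded_clinearD[OF assms(1)]
  have real: "Im (cinner z (P z)) = 0" for z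
    using pos[of z] by (auto elim!: nonneg_Reals_cases)
  have "Im (cinner x (P y)) + Im (cinner y (P x)) = 0"
    using real[of "x + y"] real[of x] real[of y]
    by (simp add: P(3) cinner_add_left cinner_add_right)
  moreover have "Re (cinner x (P y)) - Re (cinner y (P x)) = 0"
    using real[of "x + \<i> *\<^sub>C y"] real[of x] real[of y]
    by (simp add: P(2,3) cinner_add_left cinner_add_right cinner_scaleC_left cinner_scaleC_right)
  moreover have "cinner (P x) y = cnj (cinner y (P x))"
    by (rule cinner_commute)
  ultimately show ?thesis
    by (simp add: complex_eq_iff)
qed

text \<open>Absolute summability of \<open>c\<close>, the trace class case, makes the series
  converge in norm. At a basis vector a single term survives, whatever \<open>c\<close> is.\<close>

definition diag_op :: "('j \<Rightarrow> 'h::chilbert_space) \<Rightarrow> ('j \<Rightarrow> complex) \<Rightarrow> 'h \<Rightarrow> 'h" where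
  "diag_op e c x = (\<Sum>\<^sub>\<infinity>j. (c j * cinner (e j) x) *\<^sub>C e j)"

locale onb_family =
  fixes e :: "'j \<Rightarrow> 'h::chilbert_space"
  assumes inj_e: "inj e" and onb: "orthonormal_basis (range e)"
begin

lemma cinner_e: "cinner (e j) (e k) = of_bool (j = k)"
  using onb inj_e by (simp add: orthonormal_basis_def inj_eq)

lemma norm_e [simp]: "norm (e j) = 1"
proof -
  have "(norm (e j))\<^sup>2 = 1"
    using cinner_e[of j j] Re_cinner_self[of "e j"] by simp
  then show ?thesis
    using norm_ge_zero[of "e j"] by (simp only: power2_eq_1_iff) linarith
qed

lemma dense: "closure (module.span (*\<^sub>C) (range e)) = UNIV"
  using onb by (simp add: orthonormal_basis_def)

lemma eq_on_basis:
  assumes "bounded_clinear S" "bounded_clinear T" "\<And>j. S (e j) = T (e j)"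
  shows "S = T"
  by (rule bounded_clinear_eqI[OF dense]) (use assms in auto)

lemma norm_term_le: "norm ((c j * cinner (e j) x) *\<^sub>C e j) \<le> cmod (c j) * norm x"
  using norm_cinner_le[of "e j" x] by (simp add: norm_scaleC norm_mult mult_left_mono)

lemma terms_abs_summable:
  assumes "c abs_summable_on UNIV"
  shows "(\<lambda>j. (c j * cinner (e j) x) *\<^sub>C e j) abs_summable_on UNIV"
  using norm_term_le by (intro Infinite_Sum.abs_summable_on_comparison_test'[OF
        summable_on_cmult_left[OF assms, of "norm x"]]) blast

lemma diag_op_has_sum:
  assumes "c abs_summable_on UNIV"
  shows "((\<lambda>j. (c j * cinner (e j) x) *\<^sub>C e j) has_sum diag_op e c x) UNIV"
  unfolding diag_op_def
  by (rule has_sum_infsum[OF abs_summable_summable[OF terms_abs_summable[OF assms]]])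

lemma bounded_clinear_diag_op:
  assumes c: "c abs_summable_on UNIV"
  shows "bounded_clinear (diag_op e c)"
proof (rule bounded_clinear_intro)
  note has_sum = diag_op_has_sum[OF c]
  show "diag_op e c (x + y) = diag_op e c x + diag_op e c y" for x y
    using has_sum_add[OF has_sum has_sum, of x y]
    by (intro has_sum_unique[OF has_sum])
      (simp add: cinner_add_right distrib_left scaleC_add_left)
  show "diag_op e c (a *\<^sub>C x) = a *\<^sub>C diag_op e c x" for a x
    using has_sum_bounded_linear[OF bounded_linear_scaleC_right[of a] has_sum[of x]]
    by (intro has_sum_unique[OF has_sum])
      (simp add: cinner_scaleC_right scaleC_scaleC mult_ac)
  show "norm (diag_op e c x) \<le> norm x * (\<Sum>\<^sub>\<infinity>j. cmod (c j))" for x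
  proof -
    have "norm (diag_op e c x) \<le> (\<Sum>\<^sub>\<infinity>j. norm ((c j * cinner (e j) x) *\<^sub>C e j))"
      unfolding diag_op_def by (intro norm_infsum_bound terms_abs_summable c)
    also have "\<dots> \<le> (\<Sum>\<^sub>\<infinity>j. cmod (c j) * norm x)"
      by (intro infsum_mono terms_abs_summable c summable_on_cmult_left norm_term_le)
    also have "\<dots> = norm x * (\<Sum>\<^sub>\<infinity>j. cmod (c j))"
      by (simp add: infsum_cmult_right' mult.commute)
    finally show ?thesis .
  qed
qed

lemma diag_op_finite:
  assumes "finite F" "\<And>j. j \<notin> F \<Longrightarrow> c j = 0"
  shows "diag_op e c x = (\<Sum>j\<in>F. (c j * cinner (e j) x) *\<^sub>C e j)"
  unfolding diag_op_def
  by (intro infsumI has_sum_finite_neutralI[of F]) (use assms in auto)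

lemma diag_op_basis: "diag_op e c (e k) = c k *\<^sub>C e k"
proof -
  have "((\<lambda>j. (c j * cinner (e j) (e k)) *\<^sub>C e j) has_sum c k *\<^sub>C e k) UNIV"
    by (rule has_sum_finite_neutralI[of "{k}"]) (auto simp: cinner_e)
  then show ?thesis
    by (simp add: diag_op_def infsumI)
qed

section \<open>Adjoint, absolute value and trace norm of diagonal operators\<close>

lemma complex_mult_cnj_self:
  "z * cnj z = complex_of_real (cmod z) * complex_of_real (cmod z)"
  using complex_norm_square[of z] by (simp add: power2_eq_square)

lemma abs_summable_cnj: "c abs_summable_on A \<Longrightarrow> (\<lambda>j. cnj (c j)) abs_summable_on A"
  by simp

lemma diag_op_adjoint:
  assumes c: "c abs_summable_on UNIV"
  shows "cinner (diag_op e c x) y = cinner x (diag_op e (\<lambda>j. cnj (c j)) y)"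
proof -
  have "((\<lambda>j. cnj (c j) * cinner (e j) y * cnj (cinner (e j) x)) has_sum
      cinner x (diag_op e (\<lambda>j. cnj (c j)) y)) UNIV"
    using has_sum_bounded_linear[OF bounded_linear_cinner_right
        diag_op_has_sum[OF abs_summable_cnj[OF c], of y], of x]
    by (simp add: cinner_scaleC_right flip: cinner_commute)
  moreover have "((\<lambda>j. cnj (c j) * cinner (e j) y * cnj (cinner (e j) x)) has_sum
      cinner (diag_op e c x) y) UNIV"
    using has_sum_bounded_linear[OF bounded_linear_cinner_left diag_op_has_sum[OF c, of x], of y]
    by (simp add: cinner_scaleC_left mult_ac)
  ultimately show ?thesis
    by (rule has_sum_unique[rotated])
qed

text \<open>A sum of non-negative reals is the form to which positivity and Tonelli's theorem apply;
  the second part carries results about it back to the complex quadratic form.\<close>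

lemma cinner_diag_op_abs:
  assumes c: "c abs_summable_on UNIV"
  shows "((\<lambda>j. cmod (c j) * (cmod (cinner x (e j)))\<^sup>2) has_sum
      Re (cinner x (diag_op e (\<lambda>j. of_real (cmod (c j))) x))) UNIV"
    and "cinner x (diag_op e (\<lambda>j. of_real (cmod (c j))) x)
      = of_real (Re (cinner x (diag_op e (\<lambda>j. of_real (cmod (c j))) x)))"
proof -
  have "(\<lambda>j. complex_of_real (cmod (c j))) abs_summable_on UNIV"
    using c by simp
  from has_sum_bounded_linear[OF bounded_linear_cinner_right diag_op_has_sum[OF this, of x], of x]
  have *: "((\<lambda>j. cmod (c j) * cinner (e j) x * cinner x (e j)) has_sum
      cinner x (diag_op e (\<lambda>j. of_real (cmod (c j))) x)) UNIV"
    by (simp add: cinner_scaleC_right)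
  have "cinner (e j) x * cinner x (e j) = of_real ((cmod (cinner x (e j)))\<^sup>2)" for j
    by (subst cinner_commute[of "e j" x])
      (simp add: mult.commute[of "cnj _"] complex_mult_cnj_self power2_eq_square)
  then have eq: "cmod (c j) * cinner (e j) x * cinner x (e j)
      = complex_of_real (cmod (c j) * (cmod (cinner x (e j)))\<^sup>2)" for j
    by (simp add: mult.assoc)
  from has_sum_Re[OF *[unfolded eq]]
  show 1: "((\<lambda>j. cmod (c j) * (cmod (cinner x (e j)))\<^sup>2) has_sum
      Re (cinner x (diag_op e (\<lambda>j. of_real (cmod (c j))) x))) UNIV"
    by simp
  show "cinner x (diag_op e (\<lambda>j. of_real (cmod (c j))) x)
      = of_real (Re (cinner x (diag_op e (\<lambda>j. of_real (cmod (c j))) x)))"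
    by (rule has_sum_unique[OF *[unfolded eq] has_sum_of_real[OF 1]])
qed

lemma is_abs_diag_op:
  assumes c: "c abs_summable_on UNIV"
  shows "is_abs (diag_op e c) (diag_op e (\<lambda>j. of_real (cmod (c j))))" (is "is_abs ?T ?P")
  unfolding is_abs_def
proof (intro conjI allI)
  have c': "(\<lambda>j. complex_of_real (cmod (c j))) abs_summable_on UNIV"
    using c by simp
  show "bounded_clinear ?P"
    by (rule bounded_clinear_diag_op[OF c'])
  show "cinner x (?P x) \<in> \<real>\<^sub>\<ge>\<^sub>0" for x
  proof (subst cinner_diag_op_abs(2)[OF c], rule iffD2[OF nonneg_Reals_of_real_iff])
    show "0 \<le> Re (cinner x (?P x))"
      by (rule has_sum_nonneg[OF cinner_diag_op_abs(1)[OF c]]) simp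
  qed
  note bounded = bounded_clinear_diag_op[OF c] bounded_clinear_diag_op[OF c']
    bounded_clinear_diag_op[OF abs_summable_cnj[OF c]]
  \<comment> \<open>With all operators moved to the right argument the last condition of
    \<open>is_abs\<close> becomes an operator identity, and on \<open>e j\<close> it reads
    \<open>cmod c * cmod c = cnj c * c\<close>.\<close>
  have "(\<lambda>x. ?P (?P x)) = (\<lambda>x. diag_op e (\<lambda>j. cnj (c j)) (?T x))"
  proof (rule eq_on_basis)
    show "?P (?P (e j)) = diag_op e (\<lambda>j. cnj (c j)) (?T (e j))" for j
      by (simp add: diag_op_basis bounded[THEN bounded_clinearD(2)] scaleC_scaleC
          complex_mult_cnj_self)
  qed (rule bounded_clinear_compose[OF bounded(2,2)] bounded_clinear_compose[OF bounded(3,1)])+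
  then have "?P (?P y) = diag_op e (\<lambda>j. cnj (c j)) (?T y)" for y
    by (rule fun_cong)
  then show "cinner (?P x) (?P y) = cinner (?T x) (?T y)" for x y
    using diag_op_adjoint[OF c, of x "?T y"] diag_op_adjoint[OF c', of x "?P y"] by simp
qed

text \<open>Uniqueness of the positive square root, argued at one eigenvector of the square at a
  time. It makes the definite description in \<open>trace_norm\<close> well determined.\<close>

lemma is_abs_diag_op_unique:
  assumes c: "c abs_summable_on UNIV" and P: "is_abs (diag_op e c) P"
  shows "P = diag_op e (\<lambda>j. of_real (cmod (c j)))"
proof (rule eq_on_basis)
  have c': "(\<lambda>j. complex_of_real (cmod (c j))) abs_summable_on UNIV"
    using c by simp
  show bP: "bounded_clinear P"
    using P by (simp add: is_abs_def)
  have pos: "cinner x (P x) \<in> \<real>\<^sub>\<ge>\<^sub>0" for x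
    using P by (simp add: is_abs_def)
  have sym: "cinner (P x) y = cinner x (P y)" for x y
    by (rule is_abs_symmetric[OF bP pos])
  show "bounded_clinear (diag_op e (\<lambda>j. of_real (cmod (c j))))"
    by (rule bounded_clinear_diag_op[OF c'])
  fix j
  define r where "r = complex_of_real (cmod (c j))"
  have PP: "P (P (e j)) = (r * r) *\<^sub>C e j"
  proof -
    have "cinner x (P (P (e j))) = cinner x ((r * r) *\<^sub>C e j)" for x
    proof -
      have "cinner x (P (P (e j))) = cinner (P x) (P (e j))"
        by (simp add: sym)
      also have "\<dots> = cinner (diag_op e c x) (diag_op e c (e j))"
        using P by (simp add: is_abs_def)
      also have "\<dots> = cinner x ((r * r) *\<^sub>C e j)"
        using bounded_clinearD(2)[OF bounded_clinear_diag_op[OF abs_summable_cnj[OF c]]]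
        by (simp add: diag_op_adjoint[OF c] diag_op_basis scaleC_scaleC r_def
            complex_mult_cnj_self)
      finally show ?thesis .
    qed
    then have "cinner (P (P (e j)) - (r * r) *\<^sub>C e j) (P (P (e j)) - (r * r) *\<^sub>C e j) = 0"
      by (simp add: cinner_diff_right)
    then show ?thesis
      by (simp add: cinner_eq_zero_iff)
  qed
  \<comment> \<open>Since \<open>P\<^sup>2 - r\<^sup>2\<close> kills \<open>e j\<close> and factors
    as \<open>(P + r) (P - r)\<close>, the vector \<open>y\<close> is an eigenvector of
    \<open>P\<close> for \<open>- r\<close> unless it is 0. Positivity excludes this for
    \<open>r > 0\<close>; for \<open>r = 0\<close> the norm of \<open>P (e j)\<close> is computed
    directly.\<close>
  define y where "y = P (e j) - r *\<^sub>C e j"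
  have y: "P y = - (r *\<^sub>C y)"
    by (simp add: y_def bounded_clinearD[OF bP] PP scaleC_scaleC
        complex_vector.scale_right_diff_distrib)
  have "y = 0"
  proof (cases "r = 0")
    case True
    then have "cinner (P (e j)) (P (e j)) = 0"
      using PP by (simp add: sym)
    then show ?thesis
      using True by (simp add: y_def cinner_eq_zero_iff)
  next
    case False
    have "0 \<le> Re (cinner y (P y))"
      using pos[of y] by (auto elim!: nonneg_Reals_cases)
    also have "\<dots> = - cmod (c j) * (norm y)\<^sup>2"
      by (simp add: y cinner_minus_right cinner_scaleC_right r_def cinner_self del: of_real_power)
    finally show ?thesis
      using False by (auto simp: r_def mult_le_0_iff)
  qed
  then show "P (e j) = diag_op e (\<lambda>j. of_real (cmod (c j))) (e j)"
    by (simp add: diag_op_basis y_def r_def)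
qed

text \<open>Tonelli's theorem moves the sum over an arbitrary orthonormal basis inside, where
  Parseval's identity evaluates it.\<close>

lemma has_sum_trace_abs_diag_op:
  assumes c: "c abs_summable_on UNIV" and E: "orthonormal_basis E"
  shows "((\<lambda>x. cinner x (diag_op e (\<lambda>j. of_real (cmod (c j))) x)) has_sum
      complex_of_real (\<Sum>\<^sub>\<infinity>j. cmod (c j))) E"
proof -
  have inner: "((\<lambda>x. cmod (c j) * (cmod (cinner x (e j)))\<^sup>2) has_sum cmod (c j)) E" for j
    using has_sum_cmult_right[OF parseval[OF E, of "e j"], of "cmod (c j)"] by simp
  have "((\<lambda>(j, x). cmod (c j) * (cmod (cinner x (e j)))\<^sup>2) has_sum (\<Sum>\<^sub>\<infinity>j. cmod (c j))) (UNIV \<times> E)"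
    by (rule has_sum_SigmaI[where g = "\<lambda>j. cmod (c j)"])
      (use inner c in \<open>auto intro!: summable_on_SigmaI[where g = "\<lambda>j. cmod (c j)"]\<close>)
  then have "((\<lambda>(x, j). cmod (c j) * (cmod (cinner x (e j)))\<^sup>2) has_sum (\<Sum>\<^sub>\<infinity>j. cmod (c j)))
      (E \<times> UNIV)"
    by (subst (asm) has_sum_swap) (simp add: case_prod_unfold)
  then have "((\<lambda>x. Re (cinner x (diag_op e (\<lambda>j. of_real (cmod (c j))) x))) has_sum
      (\<Sum>\<^sub>\<infinity>j. cmod (c j))) E"
    by (rule has_sum_SigmaD) (use cinner_diag_op_abs(1)[OF c] in auto)
  from has_sum_of_real[OF this, where 'a = complex] show ?thesis
    by (simp only: cinner_diag_op_abs(2)[OF c, symmetric])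
qed

lemma trace_class_diag_op:
  assumes "c abs_summable_on UNIV"
  shows "trace_class (diag_op e c)"
  unfolding trace_class_def
  using bounded_clinear_diag_op[OF assms] is_abs_diag_op[OF assms]
    has_sum_trace_abs_diag_op[OF assms] by (meson has_sum_imp_summable)

text \<open>Any competing value is tested in the basis \<open>range e\<close>, where uniqueness of
  the absolute value and of sums identifies it.\<close>

lemma trace_norm_diag_op:
  assumes "c abs_summable_on UNIV"
  shows "trace_norm (diag_op e c) = (\<Sum>\<^sub>\<infinity>j. cmod (c j))"
  unfolding trace_norm_def
proof (rule the_equality)
  show "\<exists>P. is_abs (diag_op e c) P \<and> (\<forall>E. orthonormal_basis E \<longrightarrow>
      ((\<lambda>x. cinner x (P x)) has_sum complex_of_real (\<Sum>\<^sub>\<infinity>j. cmod (c j))) E)"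
    using is_abs_diag_op[OF assms] has_sum_trace_abs_diag_op[OF assms] by blast
  fix r
  assume "\<exists>P. is_abs (diag_op e c) P \<and> (\<forall>E. orthonormal_basis E \<longrightarrow>
      ((\<lambda>x. cinner x (P x)) has_sum complex_of_real r) E)"
  then have "((\<lambda>x. cinner x (diag_op e (\<lambda>j. of_real (cmod (c j))) x)) has_sum
      complex_of_real r) (range e)"
    using is_abs_diag_op_unique[OF assms] onb by blast
  from has_sum_unique[OF this has_sum_trace_abs_diag_op[OF assms onb]]
  show "r = (\<Sum>\<^sub>\<infinity>j. cmod (c j))"
    by simp
qed

lemma bounded_skewhermitian_diag_op:
  assumes "s abs_summable_on UNIV"
  shows "bounded_skewhermitian (diag_op e (\<lambda>j. \<i> * complex_of_real (s j)))"
  unfolding bounded_skewhermitian_def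
proof (intro conjI allI)
  have s: "(\<lambda>j. \<i> * complex_of_real (s j)) abs_summable_on UNIV"
    using assms by (simp add: norm_mult)
  then show "bounded_clinear (diag_op e (\<lambda>j. \<i> * complex_of_real (s j)))"
    by (rule bounded_clinear_diag_op)
  have "diag_op e (\<lambda>j. - (\<i> * complex_of_real (s j))) y
      = - diag_op e (\<lambda>j. \<i> * complex_of_real (s j)) y" for y
    by (simp add: diag_op_def flip: infsum_uminus)
  then show "cinner (diag_op e (\<lambda>j. \<i> * complex_of_real (s j)) x) y
      = - cinner x (diag_op e (\<lambda>j. \<i> * complex_of_real (s j)) y)" for x y
    by (simp add: diag_op_adjoint[OF s] cinner_minus_right)
qed

lemma diag_op_mem_u1:
  "s abs_summable_on UNIV \<Longrightarrow> diag_op e (\<lambda>j. \<i> * complex_of_real (s j)) \<in> u1"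
  by (simp add: u1_def bounded_skewhermitian_diag_op trace_class_diag_op norm_mult)

lemma bounded_selfadjoint_diag_op:
  assumes "s abs_summable_on UNIV"
  shows "bounded_selfadjoint (diag_op e (\<lambda>j. complex_of_real (s j)))"
proof -
  have s: "(\<lambda>j. complex_of_real (s j)) abs_summable_on UNIV"
    using assms by simp
  show ?thesis
    by (simp add: bounded_selfadjoint_def bounded_clinear_diag_op[OF s] diag_op_adjoint[OF s])
qed

end

section \<open>Exponentials\<close>

lemma bounded_clinear_funpow:
  "bounded_clinear T \<Longrightarrow> bounded_clinear (T ^^ n)" for T :: "'a::chilbert_space \<Rightarrow> 'a"
proof (induction n)
  case 0
  then show ?case
    by (simp add: id_def bounded_clinear_id)
next
  case (Suc n)
  then show ?case
    using bounded_clinear_compose[of T "T ^^ n"] by (simp add: o_def)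
qed

lemma norm_funpow_le:
  assumes "bounded_clinear (T :: 'a::chilbert_space \<Rightarrow> 'a)"
  shows "norm ((T ^^ n) x) \<le> onorm T ^ n * norm x"
proof (induction n)
  case (Suc n)
  have "norm (T ((T ^^ n) x)) \<le> onorm T * norm ((T ^^ n) x)"
    by (rule onorm[OF bounded_clinearD(1)[OF assms]])
  also have "\<dots> \<le> onorm T * (onorm T ^ n * norm x)"
    by (rule mult_left_mono[OF Suc onorm_pos_le[OF bounded_clinearD(1)[OF assms]]])
  finally show ?case
    by (simp add: mult.assoc)
qed simp

lemma norm_op_exp_term_le:
  assumes "bounded_clinear (T :: 'a::chilbert_space \<Rightarrow> 'a)"
  shows "norm ((T ^^ n) x /\<^sub>R fact n) \<le> (onorm T ^ n /\<^sub>R fact n) * norm x"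
  using mult_left_mono[OF norm_funpow_le[OF assms, of n x], of "inverse (fact n)"]
  by (simp add: mult.assoc)

lemma exp_terms_sums: "(\<lambda>n. (r ^ n /\<^sub>R fact n) * c) sums (exp r * c)" for r :: real
  by (rule sums_mult2[OF exp_converges])

lemma op_exp_norm_summable:
  assumes "bounded_clinear (T :: 'a::chilbert_space \<Rightarrow> 'a)"
  shows "summable (\<lambda>n. norm ((T ^^ n) x /\<^sub>R fact n))"
  by (rule summable_comparison_test'[OF sums_summable[OF exp_terms_sums[of "onorm T" "norm x"]], of 0])
    (use norm_op_exp_term_le[OF assms, of _ x] in simp)

lemma bounded_clinear_op_exp:
  assumes T: "bounded_clinear (T :: 'a::chilbert_space \<Rightarrow> 'a)"
  shows "bounded_clinear (op_exp T)"
proof (rule bounded_clinear_intro)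
  note summable = summable_norm_cancel[OF op_exp_norm_summable[OF T]]
  note iterate = bounded_clinear_funpow[OF T, THEN bounded_clinearD(3)]
    bounded_clinear_funpow[OF T, THEN bounded_clinearD(2)]
  show "op_exp T (x + y) = op_exp T x + op_exp T y" for x y
    unfolding op_exp_def by (subst suminf_add[OF summable summable])
      (simp add: iterate scaleR_add_right)
  show "op_exp T (c *\<^sub>C x) = c *\<^sub>C op_exp T x" for c x
    unfolding op_exp_def
    by (subst bounded_linear.suminf[OF bounded_linear_scaleC_right summable])
      (simp add: iterate scaleC_scaleR)
  show "norm (op_exp T x) \<le> norm x * exp (onorm T)" for x
  proof -
    have "norm (op_exp T x) \<le> (\<Sum>n. norm ((T ^^ n) x /\<^sub>R fact n))"
      unfolding op_exp_def by (rule summable_norm[OF op_exp_norm_summable[OF T]])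
    also have "\<dots> \<le> (\<Sum>n. (onorm T ^ n /\<^sub>R fact n) * norm x)"
      by (rule suminf_le[OF norm_op_exp_term_le[OF T] op_exp_norm_summable[OF T]
            sums_summable[OF exp_terms_sums]])
    also have "\<dots> = norm x * exp (onorm T)"
      using sums_unique[OF exp_terms_sums[of "onorm T" "norm x"]] by (simp add: mult.commute)
    finally show ?thesis .
  qed
qed

text \<open>Serves both spaces: diagonal operators at basis vectors, and derived operators
  \<open>d\<rho> X\<close> at weight vectors.\<close>

lemma op_exp_eigenvector:
  assumes "\<And>a x. T (a *\<^sub>C x) = a *\<^sub>C T x" and "T v = c *\<^sub>C (v :: 'a::chilbert_space)"
  shows "op_exp T v = exp c *\<^sub>C v"
proof -
  have "(T ^^ n) v = c ^ n *\<^sub>C v" for n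
    by (induction n) (simp_all add: assms scaleC_scaleC mult.commute)
  moreover have "(\<lambda>n. (c ^ n /\<^sub>R fact n) *\<^sub>C v) sums (exp c *\<^sub>C v)"
    by (rule bounded_linear.sums[OF bounded_linear_scaleC_left exp_converges])
  then have "(\<lambda>n. (c ^ n *\<^sub>C v) /\<^sub>R fact n) sums (exp c *\<^sub>C v)"
    by (simp add: linear_simps(5)[OF bounded_linear_scaleC_left])
  ultimately show ?thesis
    by (simp add: op_exp_def sums_iff)
qed

definition flow :: "('h::chilbert_space \<Rightarrow> 'h) \<Rightarrow> real \<Rightarrow> 'h \<Rightarrow> 'h" where
  "flow B t = op_exp (\<lambda>x. (\<i> * of_real t) *\<^sub>C B x)"

lemma conj_action_flow: "conj_action B t g = flow B t \<circ> g \<circ> flow B (- t)"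
  by (simp add: conj_action_def flow_def)

lemma bounded_clinear_flow: "bounded_clinear B \<Longrightarrow> bounded_clinear (flow B t)"
  unfolding flow_def by (intro bounded_clinear_op_exp bounded_clinear_scaleC)

context onb_family
begin

lemma flow_basis:
  assumes "bounded_clinear B" "B (e j) = complex_of_real (b j) *\<^sub>C e j"
  shows "flow B t (e j) = cis (t * b j) *\<^sub>C e j"
proof -
  have "op_exp (\<lambda>x. (\<i> * of_real t) *\<^sub>C B x) (e j) = exp (\<i> * of_real t * of_real (b j)) *\<^sub>C e j"
    by (rule op_exp_eigenvector)
      (use assms in \<open>simp_all add: bounded_clinearD scaleC_scaleC mult_ac\<close>)
  then show ?thesis
    by (simp add: flow_def cis_conv_exp mult_ac)
qed

lemma flow_zero:
  assumes "bounded_clinear B" "\<And>j. B (e j) = complex_of_real (b j) *\<^sub>C e j"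
  shows "flow B 0 = id"
  unfolding id_def
  by (rule eq_on_basis)
    (use assms in \<open>simp_all add: bounded_clinear_flow bounded_clinear_id flow_basis[where b = b]\<close>)

text \<open>Diagonal exponents add on each basis vector. Three operators with separate times let one
  statement yield the group law, inverses (with \<open>u = 0\<close>) and the splitting of the flow
  of a difference into commuting factors.\<close>

lemma flow_compose:
  assumes "bounded_clinear B" "\<And>j. B (e j) = complex_of_real (b j) *\<^sub>C e j"
    and "bounded_clinear C" "\<And>j. C (e j) = complex_of_real (c j) *\<^sub>C e j"
    and "bounded_clinear D" "\<And>j. D (e j) = complex_of_real (d j) *\<^sub>C e j"
    and eq: "\<And>j. s * b j + t * c j = u * d j"
  shows "flow B s \<circ> flow C t = flow D u"
  unfolding o_def
proof (rule eq_on_basis)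
  show "bounded_clinear (\<lambda>x. flow B s (flow C t x))"
    using assms by (intro bounded_clinear_compose[of "flow B s" "flow C t"] bounded_clinear_flow)
  show "bounded_clinear (flow D u)"
    using assms by (intro bounded_clinear_flow)
  show "flow B s (flow C t (e j)) = flow D u (e j)" for j
    using assms eq[of j] by (simp add: flow_basis[where b = b] flow_basis[where b = c]
        flow_basis[where b = d] bounded_clinearD(2)[OF bounded_clinear_flow] scaleC_scaleC
        cis_mult add.commute)
qed

text \<open>The adjoint of \<open>flow B t\<close> is \<open>flow B (- t)\<close>; this is checked
  on pairs of basis vectors and extended by density in one argument after the other.\<close>

lemma unitary_op_flow:
  assumes B: "bounded_clinear B" and b: "\<And>j. B (e j) = complex_of_real (b j) *\<^sub>C e j"
  shows "unitary_op (flow B t)"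
proof -
  have inverse: "flow B t \<circ> flow B (- t) = id" "flow B (- t) \<circ> flow B t = id"
    using flow_compose[OF B b B b B b, of t "- t" 0] flow_compose[OF B b B b B b, of "- t" t 0]
      flow_zero[OF B b] by simp_all
  note linear = bounded_clinear_flow[OF B]
  have *: "cinner (flow B t (e k)) y = cinner (e k) (flow B (- t) y)" for k y
  proof (rule dense_span_induct[OF dense, where P = "\<lambda>y. cinner (flow B t (e k)) y = cinner (e k) (flow B (- t) y)"])
    show "closed {y. cinner (flow B t (e k)) y = cinner (e k) (flow B (- t) y)}"
      by (rule closed_bounded_linear_eq[OF bounded_linear_cinner_right
            bounded_linear_compose[OF bounded_linear_cinner_right bounded_clinearD(1)[OF linear]]])
  qed (auto simp: bounded_clinearD[OF linear] cinner_add_right cinner_scaleC_right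
      flow_basis[OF B, where b = b] b cinner_scaleC_left cinner_e cis_cnj)
  have adjoint: "cinner (flow B t x) y = cinner x (flow B (- t) y)" for x y
  proof (rule dense_span_induct[OF dense, where P = "\<lambda>x. cinner (flow B t x) y = cinner x (flow B (- t) y)"])
    show "closed {x. cinner (flow B t x) y = cinner x (flow B (- t) y)}"
      by (rule closed_bounded_linear_eq[OF
            bounded_linear_compose[OF bounded_linear_cinner_left bounded_clinearD(1)[OF linear]]
            bounded_linear_cinner_left])
  qed (auto simp: bounded_clinearD[OF linear] cinner_add_left cinner_scaleC_left *)
  show ?thesis
    unfolding unitary_op_def
  proof (intro conjI allI linear)
    show "surj (flow B t)"
      using inverse(1) by (metis comp_apply id_apply surjI)
    show "cinner (flow B t x) (flow B t y) = cinner x y" for x y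
      using fun_cong[OF inverse(2), of y] by (simp add: adjoint)
  qed
qed

lemma flow_mem_U1:
  assumes s: "s abs_summable_on UNIV"
  shows "flow (diag_op e (\<lambda>j. complex_of_real (s j))) t \<in> carrier U1"
proof -
  let ?S = "diag_op e (\<lambda>j. complex_of_real (s j))"
  have bounded: "bounded_clinear ?S"
    by (rule bounded_clinear_diag_op) (use s in simp)
  \<comment> \<open>A chord is no longer than its arc:
    \<open>cmod (cis x - 1) = 2 * \<bar>sin (x / 2)\<bar>\<close>. Hence the diagonal entries of the
    flow minus the identity inherit summability from \<open>s\<close>.\<close>
  have le: "cmod (cis (t * s j) - 1) \<le> norm (t * s j)" for j
  proof -
    have "(cmod (cis (t * s j) - 1))\<^sup>2 = 2 - 2 * cos (t * s j)"
      using sin_cos_squared_add[of "t * s j"] by (simp add: cmod_power2 power2_diff)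
    also have "\<dots> = (2 * sin (t * s j / 2))\<^sup>2"
      using cos_double_sin[of "t * s j / 2"] by (simp add: power_mult_distrib)
    also have "\<dots> \<le> (t * s j)\<^sup>2"
      using abs_sin_x_le_abs_x[of "t * s j / 2"]
      unfolding abs_le_square_iff[symmetric] by (simp add: abs_mult)
    finally show ?thesis
      using abs_le_square_iff[of "cmod (cis (t * s j) - 1)" "t * s j"] by simp
  qed
  have summable: "(\<lambda>j. cis (t * s j) - 1) abs_summable_on UNIV"
    by (rule Infinite_Sum.abs_summable_on_comparison_test[of "\<lambda>j. t * s j"])
      (use le summable_on_cmult_right[OF s, of "\<bar>t\<bar>"] in \<open>auto simp: abs_mult\<close>)
  have "(\<lambda>x. flow ?S t x - x) = diag_op e (\<lambda>j. cis (t * s j) - 1)"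
    by (rule eq_on_basis)
      (simp_all add: bounded_clinear_sub bounded_clinear_flow[OF bounded] bounded_clinear_id
        bounded_clinear_diag_op[OF summable] diag_op_basis flow_basis[OF bounded, where b = s]
        complex_vector.scale_left_diff_distrib)
  with trace_class_diag_op[OF summable] show ?thesis
    by (simp add: U1_def unitary_op_flow[OF bounded, where b = s] diag_op_basis)
qed

end

section \<open>Weights of the highest weight module\<close>

lemma matrix_unit_gl: "matrix_unit j k \<in> gl"
  unfolding gl_def mem_Collect_eq
  by (rule finite_subset[of _ "{(j, k)}"]) (auto simp: matrix_unit_def)

lemma add_gl: "X \<in> gl \<Longrightarrow> Y \<in> gl \<Longrightarrow> (\<lambda>j k. X j k + Y j k) \<in> gl"
  unfolding gl_def mem_Collect_eq
  by (rule finite_subset[of _ "{(j, k). X j k \<noteq> 0} \<union> {(j, k). Y j k \<noteq> 0}"]) auto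

lemma scale_gl: "X \<in> gl \<Longrightarrow> (\<lambda>j k. c * X j k) \<in> gl"
  unfolding gl_def by (auto elim!: rev_finite_subset)

lemma mat_adj_matrix_unit: "mat_adj (matrix_unit j k) = matrix_unit k j"
  by (auto simp: mat_adj_def matrix_unit_def fun_eq_iff)

lemma mat_mult_matrix_unit: "mat_mult (matrix_unit a b) Y = (\<lambda>i k. of_bool (i = a) * Y b k)"
proof (intro ext)
  fix i k
  have "{j. matrix_unit a b i j \<noteq> 0} = (if i = a then {b} else {})"
    by (auto simp: matrix_unit_def)
  then show "mat_mult (matrix_unit a b) Y i k = of_bool (i = a) * Y b k"
    by (simp add: mat_mult_def) (simp add: matrix_unit_def)
qed

text \<open>The difference is written as a sum with a negative scalar, the shape to which
  \<open>add_act\<close> and \<open>scale_act\<close> apply.\<close>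

lemma bracket_matrix_unit:
  "mat_bracket (matrix_unit a b) (matrix_unit c d) =
    (\<lambda>i k. of_bool (b = c) * matrix_unit a d i k + (- of_bool (d = a)) * matrix_unit c b i k)"
  unfolding mat_bracket_def mat_mult_matrix_unit by (auto simp: matrix_unit_def fun_eq_iff)

context unitary_highest_weight_module
begin

lemma subspace_V: "x \<in> V \<Longrightarrow> y \<in> V \<Longrightarrow> x + y \<in> V" "x \<in> V \<Longrightarrow> c *\<^sub>C x \<in> V" "0 \<in> V"
  using subspace complex_vector.subspace_add complex_vector.subspace_scale
    complex_vector.subspace_0 by blast+

lemma act_zero: "X \<in> gl \<Longrightarrow> act X 0 = 0"
  using act_scale[of X 0 0] subspace_V by simp

lemma act_unit_closed: "v \<in> V \<Longrightarrow> act (matrix_unit a b) v \<in> V"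
  by (intro act_closed matrix_unit_gl)

lemma act_unit_commute:
  assumes "v \<in> V"
  shows "act (matrix_unit a b) (act (matrix_unit c d) v) =
    act (matrix_unit c d) (act (matrix_unit a b) v) +
    of_bool (b = c) *\<^sub>C act (matrix_unit a d) v - of_bool (d = a) *\<^sub>C act (matrix_unit c b) v"
proof -
  have "act (mat_bracket (matrix_unit a b) (matrix_unit c d)) v
      = act (\<lambda>i k. of_bool (b = c) * matrix_unit a d i k) v
        + act (\<lambda>i k. (- of_bool (d = a)) * matrix_unit c b i k) v"
    unfolding bracket_matrix_unit by (intro add_act scale_gl matrix_unit_gl assms)
  also have "\<dots> = of_bool (b = c) *\<^sub>C act (matrix_unit a d) v
      - of_bool (d = a) *\<^sub>C act (matrix_unit c b) v"
    unfolding scale_act[OF matrix_unit_gl assms] by simp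
  finally show ?thesis
    by (simp add: act_bracket[OF matrix_unit_gl matrix_unit_gl assms] algebra_simps)
qed

lemma weight_spaceD:
  assumes "v \<in> weight_space V act \<mu>"
  shows "v \<in> V" "act (matrix_unit j j) v = of_int (\<mu> j) *\<^sub>C v"
  using assms by (auto simp: weight_space_def)

lemma subspace_weight_space: "module.subspace (*\<^sub>C) (weight_space V act \<mu>)"
  by (rule complex_vector.subspaceI)
    (auto simp: weight_space_def subspace_V act_add act_scale act_zero matrix_unit_gl
      scaleC_add_right scaleC_scaleC mult.commute)

lemma act_unit_weight_space:
  assumes v: "v \<in> weight_space V act \<mu>"
  shows "act (matrix_unit k j) v \<in> weight_space V act (\<lambda>i. \<mu> i + root k j i)"
proof -
  note [simp] = weight_spaceD[OF v]
  have "act (matrix_unit i i) (act (matrix_unit k j) v)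
      = of_int (\<mu> i + root k j i) *\<^sub>C act (matrix_unit k j) v" for i
    by (subst act_unit_commute)
      (auto simp: act_scale matrix_unit_gl root_def scaleC_add_left
        complex_vector.scale_left_diff_distrib)
  then show ?thesis
    by (simp add: weight_space_def act_unit_closed)
qed

text \<open>The \<open>sl\<^sub>2\<close> relation: contravariance makes the two units adjoint, and
  their commutator is a difference of diagonal units. As the other norm is non-negative, moving a
  unit from \<open>j\<close> to \<open>k\<close> cannot kill a nonzero vector if
  \<open>\<mu> k < \<mu> j\<close>.\<close>

lemma norm_act_unit:
  assumes v: "v \<in> weight_space V act \<mu>"
  shows "(norm (act (matrix_unit k j) v))\<^sup>2
    = (norm (act (matrix_unit j k) v))\<^sup>2 + of_int (\<mu> j - \<mu> k) * (norm v)\<^sup>2"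
proof -
  note [simp] = weight_spaceD[OF v] act_unit_closed
  let ?u = "act (matrix_unit k j) v" and ?w = "act (matrix_unit j k) v"
  have "cinner ?u ?u = cinner v (act (matrix_unit j k) ?u)"
    by (simp add: contravariant matrix_unit_gl mat_adj_matrix_unit)
  also have "act (matrix_unit j k) ?u
      = act (matrix_unit k j) ?w + of_int (\<mu> j) *\<^sub>C v - of_int (\<mu> k) *\<^sub>C v"
    by (subst act_unit_commute) simp_all
  also have "cinner v \<dots> = cinner v (act (matrix_unit k j) ?w) + of_int (\<mu> j - \<mu> k) * cinner v v"
    by (simp add: cinner_add_right cinner_diff_right cinner_scaleC_right algebra_simps)
  also have "cinner v (act (matrix_unit k j) ?w) = cinner ?w ?w"
    by (simp add: contravariant matrix_unit_gl mat_adj_matrix_unit)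
  finally have "Re (cinner ?u ?u) = Re (cinner ?w ?w + of_int (\<mu> j - \<mu> k) * cinner v v)"
    by simp
  then show ?thesis
    by (simp add: Re_cinner_self)
qed

lemma hw_weight_space: "v\<^sub>0 \<in> weight_space V act lam"
  by (simp add: weight_space_def hw_mem hw_weight)

text \<open>If \<open>lam j = lam k\<close>, both root vectors for \<open>j\<close> and \<open>k\<close> annihilate \<open>v\<^sub>0\<close>: one of them by the
  highest weight condition, the other by unitarity.\<close>

lemma hw_annihilated_le:
  assumes "a \<noteq> b" "lam b \<le> lam a"
  shows "act (matrix_unit a b) v\<^sub>0 = 0"
proof -
  have "root a b \<in> roots"
    using assms(1) by (auto simp: roots_def)
  then have "root a b \<in> pos \<or> (\<exists>\<alpha>\<in>pos. root a b = (\<lambda>i. - \<alpha> i))"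
    using pos by (auto simp: positive_system_def)
  moreover have "root b a \<in> pos" if "\<alpha> \<in> pos" "root a b = (\<lambda>i. - \<alpha> i)" for \<alpha>
  proof -
    have "root b a i = \<alpha> i" for i
      using fun_cong[OF that(2), of i] by (simp add: root_def)
    then have "root b a = \<alpha>" ..
    with that show ?thesis by simp
  qed
  ultimately consider "root a b \<in> pos" | "root b a \<in> pos"
    by blast
  then show ?thesis
  proof cases
    case 1
    then show ?thesis
      by (rule hw_annihilated)
  next
    case 2
    with dominant assms(2) have "lam a = lam b"
      by force
    with norm_act_unit[OF hw_weight_space, of a b] hw_annihilated[OF 2] show ?thesis
      by simp
  qed
qed

text \<open>Units are moved one pair at a time. Earlier moves leave the indices of the next pair
  untouched, so the current weight still satisfies the strict inequality that
  \<open>norm_act_unit\<close> needs to give a nonzero vector.\<close>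

lemma weight_exchange:
  assumes "finite F" "finite G" "card F = card G" "\<And>k j. k \<in> F \<Longrightarrow> j \<in> G \<Longrightarrow> lam k < lam j"
  shows "(\<lambda>i. lam i + of_bool (i \<in> F) - of_bool (i \<in> G)) \<in> weights V act"
  using assms
proof (induction F arbitrary: G)
  case empty
  then show ?case
    using hw_weight_space hw_nonzero by (auto simp: weights_def)
next
  case (insert k F)
  then obtain j G' where G: "G = insert j G'" "j \<notin> G'"
    by (metis card_eq_0_iff card_insert_disjoint ex_in_conv mk_disjoint_insert nat.distinct(1))
  let ?\<mu> = "\<lambda>i. lam i + of_bool (i \<in> F) - of_bool (i \<in> G')"
  have "?\<mu> \<in> weights V act"
    using insert G by (intro insert.IH) auto
  then obtain v where v: "v \<in> weight_space V act ?\<mu>" "v \<noteq> 0"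
    by (auto simp: weights_def)
  \<comment> \<open>Strictness of the hypothesis keeps \<open>F\<close> and \<open>G\<close> apart:
    a common index would satisfy \<open>lam i < lam i\<close>.\<close>
  have lam: "lam k < lam j" and "j \<notin> F" "k \<notin> G'"
    using insert.prems(3) G by auto
  then have "?\<mu> k < ?\<mu> j"
    using insert.hyps G by simp
  then have "0 < of_int (?\<mu> j - ?\<mu> k) * (norm v)\<^sup>2"
    using v(2) by (intro mult_pos_pos) (simp_all only: of_int_0_less_iff, simp_all)
  then have "0 < (norm (act (matrix_unit k j) v))\<^sup>2"
    unfolding norm_act_unit[OF v(1), of k j] by (simp add: add_nonneg_pos)
  then have "act (matrix_unit k j) v \<noteq> 0"
    by auto
  moreover have "(\<lambda>i. ?\<mu> i + root k j i) = (\<lambda>i. lam i + of_bool (i \<in> insert k F) - of_bool (i \<in> G))"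
    using insert.hyps G by (auto simp: root_def fun_eq_iff)
  ultimately show ?case
    using act_unit_weight_space[OF v(1), of k j] by (auto simp: weights_def)
qed

text \<open>Monomials in matrix units applied to \<open>v\<^sub>0\<close>, with their weights; the
  vector may be 0. Steps are ordered by strict inequality of \<open>lam\<close> instead of by
  \<open>pos\<close>: the cone of weights then involves only pairs for which antitone entries can be
  compared.\<close>

inductive lowering :: "'k \<Rightarrow> ('j \<Rightarrow> int) \<Rightarrow> bool" where
  lowering_hw: "lowering v\<^sub>0 lam"
| lowering_act: "lowering v \<mu> \<Longrightarrow> lam k < lam j \<Longrightarrow>
    lowering (act (matrix_unit k j) v) (\<lambda>i. \<mu> i + root k j i)"

lemma lowering_weight_space: "lowering v \<mu> \<Longrightarrow> v \<in> weight_space V act \<mu>"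
  by (induction rule: lowering.induct) (auto intro: hw_weight_space act_unit_weight_space)

lemma span_lowering_le: "module.span (*\<^sub>C) {v. \<exists>\<mu>. lowering v \<mu>} \<subseteq> V"
  by (rule complex_vector.span_minimal)
    (use subspace weight_spaceD(1) lowering_weight_space in blast)+

lemma act_span_lowering:
  assumes X: "X \<in> gl" and M: "\<And>v \<mu>. lowering v \<mu> \<Longrightarrow> act X v \<in> module.span (*\<^sub>C) {v. \<exists>\<mu>. lowering v \<mu>}"
    and w: "w \<in> module.span (*\<^sub>C) {v. \<exists>\<mu>. lowering v \<mu>}"
  shows "act X w \<in> module.span (*\<^sub>C) {v. \<exists>\<mu>. lowering v \<mu>}"
proof -
  let ?S = "complex_vector.span {v. \<exists>\<mu>. lowering v \<mu>}"
  have "?S \<subseteq> {w \<in> V. act X w \<in> ?S}"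
  proof (rule complex_vector.span_minimal)
    show "complex_vector.subspace {w \<in> V. act X w \<in> ?S}"
      by (rule complex_vector.subspaceI)
        (auto simp: subspace_V act_add[OF X] act_scale[OF X] act_zero[OF X]
          complex_vector.span_zero complex_vector.span_add complex_vector.span_scale)
  qed (use M lowering_weight_space weight_spaceD(1) in blast)
  with w show ?thesis by auto
qed

text \<open>Takes the place of a Poincare-Birkhoff-Witt argument. A unit is commuted past the
  outermost factor; the bracket terms are again single units acting on the shorter monomial, hence
  covered by the induction hypothesis for arbitrary \<open>a\<close> and \<open>b\<close>. At
  \<open>v\<^sub>0\<close> a unit scales, annihilates or is itself a lowering step.\<close>

lemma act_unit_lowering:
  "lowering v \<mu> \<Longrightarrow> act (matrix_unit a b) v \<in> module.span (*\<^sub>C) {v. \<exists>\<mu>. lowering v \<mu>}"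
proof (induction arbitrary: a b rule: lowering.induct)
  case lowering_hw
  consider "a = b" | "a \<noteq> b" "lam b \<le> lam a" | "lam a < lam b"
    by force
  then show ?case
  proof cases
    case 1
    then show ?thesis
      by (simp only: hw_weight)
        (intro complex_vector.span_scale complex_vector.span_base CollectI exI,
          rule lowering.lowering_hw)
  next
    case 2
    then show ?thesis
      by (simp add: hw_annihilated_le complex_vector.span_zero)
  next
    case 3
    then show ?thesis
      by (auto intro!: complex_vector.span_base dest: lowering_act[OF lowering.lowering_hw])
  qed
next
  case (lowering_act v \<mu> k j)
  have v: "v \<in> V"
    using lowering_act.hyps(1) lowering_weight_space weight_spaceD(1) by blast
  \<comment> \<open>The term with the factors interchanged: one more lowering step maps the span
    into itself.\<close>
  have "act (matrix_unit k j) (act (matrix_unit a b) v)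
      \<in> complex_vector.span {v. \<exists>\<mu>. lowering v \<mu>}"
    by (rule act_span_lowering[OF matrix_unit_gl _ lowering_act.IH])
      (auto intro!: complex_vector.span_base dest: lowering.lowering_act[OF _ lowering_act.hyps(2)])
  then show ?case
    unfolding act_unit_commute[OF v, of a b]
    by (intro complex_vector.span_diff complex_vector.span_add complex_vector.span_scale
        lowering_act.IH)
qed

lemma act_sum_units:
  assumes "finite I" "v \<in> V"
  shows "(\<lambda>j k. \<Sum>p\<in>I. a p * matrix_unit (fst p) (snd p) j k) \<in> gl \<and>
    act (\<lambda>j k. \<Sum>p\<in>I. a p * matrix_unit (fst p) (snd p) j k) v
      = (\<Sum>p\<in>I. a p *\<^sub>C act (matrix_unit (fst p) (snd p)) v)"
  using assms(1)
proof induction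
  case empty
  have "(\<lambda>j k. 0) \<in> gl"
    by (simp add: gl_def)
  with scale_act[OF this assms(2), of 0] show ?case
    by simp
next
  case (insert p I)
  have p: "(\<lambda>j k. a p * matrix_unit (fst p) (snd p) j k) \<in> gl"
    by (intro scale_gl matrix_unit_gl)
  show ?case
  proof (simp only: sum.insert[OF insert.hyps], intro conjI)
    show "(\<lambda>j k. a p * matrix_unit (fst p) (snd p) j k
        + (\<Sum>p\<in>I. a p * matrix_unit (fst p) (snd p) j k)) \<in> gl"
      using p insert.IH by (intro add_gl) auto
    show "act (\<lambda>j k. a p * matrix_unit (fst p) (snd p) j k
        + (\<Sum>p\<in>I. a p * matrix_unit (fst p) (snd p) j k)) v
      = a p *\<^sub>C act (matrix_unit (fst p) (snd p)) v
        + (\<Sum>p\<in>I. a p *\<^sub>C act (matrix_unit (fst p) (snd p)) v)"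
      using insert.IH by (simp add: add_act[OF p _ assms(2)] scale_act[OF matrix_unit_gl assms(2)])
  qed
qed

lemma act_eq_sum_units:
  assumes I: "finite I" "\<And>j k. X j k \<noteq> 0 \<Longrightarrow> (j, k) \<in> I" and v: "v \<in> V"
  shows "act X v = (\<Sum>(j, k)\<in>I. X j k *\<^sub>C act (matrix_unit j k) v)"
proof -
  have "X = (\<lambda>j k. \<Sum>p\<in>I. X (fst p) (snd p) * matrix_unit (fst p) (snd p) j k)"
  proof (intro ext)
    fix j k
    have "(\<Sum>p\<in>I. X (fst p) (snd p) * matrix_unit (fst p) (snd p) j k)
        = (\<Sum>p\<in>I. if p = (j, k) then X j k else 0)"
      by (intro sum.cong) (auto simp: matrix_unit_def prod_eq_iff)
    also have "\<dots> = X j k"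
      using I by (auto simp: sum.delta')
    finally show "X j k = (\<Sum>p\<in>I. X (fst p) (snd p) * matrix_unit (fst p) (snd p) j k)" ..
  qed
  then show ?thesis
    using act_sum_units[OF I(1) v, of "\<lambda>p. X (fst p) (snd p)"] by (simp add: case_prod_unfold)
qed

text \<open>The span is invariant under every matrix, being invariant under matrix units, and
  \<open>v\<^sub>0\<close> generates \<open>V\<close>.\<close>

lemma span_lowering: "module.span (*\<^sub>C) {v. \<exists>\<mu>. lowering v \<mu>} = V"
proof (rule generated)
  fix X :: "'j \<Rightarrow> 'j \<Rightarrow> complex" and w
  assume X: "X \<in> gl" and w: "w \<in> complex_vector.span {v. \<exists>\<mu>. lowering v \<mu>}"
  show "act X w \<in> complex_vector.span {v. \<exists>\<mu>. lowering v \<mu>}"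
  proof (rule act_span_lowering[OF X _ w])
    fix v \<mu>
    assume v: "lowering v \<mu>"
    have "act X v = (\<Sum>(j, k) | X j k \<noteq> 0. X j k *\<^sub>C act (matrix_unit j k) v)"
      using X v lowering_weight_space weight_spaceD(1)
      by (intro act_eq_sum_units) (auto simp: gl_def)
    then show "act X v \<in> complex_vector.span {v. \<exists>\<mu>. lowering v \<mu>}"
      using act_unit_lowering[OF v]
      by (auto intro!: complex_vector.span_sum complex_vector.span_scale)
  qed
qed (auto intro: complex_vector.subspace_span complex_vector.span_base lowering_hw
    subsetD[OF span_lowering_le])

section \<open>Orthogonality of weight spaces and weight decomposition\<close>

lemma weight_spaces_orthogonal:
  assumes "u \<in> weight_space V act \<mu>" "v \<in> weight_space V act \<nu>" "\<mu> \<noteq> \<nu>"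
  shows "cinner u v = 0"
proof -
  obtain j where j: "\<mu> j \<noteq> \<nu> j"
    using assms(3) by auto
  have "cinner (act (matrix_unit j j) u) v = cinner u (act (matrix_unit j j) v)"
    using contravariant[OF matrix_unit_gl, of u v j j] assms(1,2)
    by (simp add: mat_adj_matrix_unit weight_spaceD(1))
  then have "of_int (\<mu> j) * cinner u v = of_int (\<nu> j) * cinner u v"
    using assms by (simp add: weight_spaceD cinner_scaleC_left cinner_scaleC_right)
  with j show ?thesis by simp
qed

text \<open>Otherwise a weight vector of weight \<open>\<nu>\<close> would be orthogonal to every
  lowering monomial, hence to all of \<open>V\<close> and to itself.\<close>

lemma weights_lowering:
  assumes "\<nu> \<in> weights V act"
  obtains v where "lowering v \<nu>"
proof -
  obtain v where v: "v \<in> weight_space V act \<nu>" "v \<noteq> 0"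
    using assms by (auto simp: weights_def)
  have "\<exists>w. lowering w \<nu>"
  proof (rule ccontr)
    assume *: "\<nexists>w. lowering w \<nu>"
    have "V \<subseteq> {w. cinner v w = 0}"
      unfolding span_lowering[symmetric]
    proof (rule complex_vector.span_minimal)
      show "{w. \<exists>\<mu>. lowering w \<mu>} \<subseteq> {w. cinner v w = 0}"
        using * v(1) weight_spaces_orthogonal lowering_weight_space by blast
    qed (auto intro!: complex_vector.subspaceI simp: cinner_add_right cinner_scaleC_right)
    then have "cinner v v = 0"
      using weight_spaceD(1)[OF v(1)] by blast
    with v(2) show False
      by (simp add: cinner_eq_zero_iff)
  qed
  with that show thesis by blast
qed

lemma weight_decomposition:
  assumes "y \<in> V"
  obtains F f where "finite F" "F \<subseteq> weights V act" "\<And>\<mu>. \<mu> \<in> F \<Longrightarrow> f \<mu> \<in> weight_space V act \<mu>"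
    "y = (\<Sum>\<mu>\<in>F. f \<mu>)"
proof -
  \<comment> \<open>Components are defined for all \<open>\<mu>\<close> and vanish off
    \<open>F\<close>, so that two decompositions can be added over the union of their index
    sets.\<close>
  let ?S = "{y. \<exists>F f. finite F \<and> (\<forall>\<mu>. f \<mu> \<in> weight_space V act \<mu>) \<and>
      (\<forall>\<mu>. \<mu> \<notin> F \<longrightarrow> f \<mu> = 0) \<and> y = (\<Sum>\<mu>\<in>F. f \<mu>)}"
  note closed = complex_vector.subspace_add[OF subspace_weight_space]
    complex_vector.subspace_scale[OF subspace_weight_space]
    complex_vector.subspace_0[OF subspace_weight_space]
  have "complex_vector.span {v. \<exists>\<mu>. lowering v \<mu>} \<subseteq> ?S"
  proof (rule complex_vector.span_minimal)
    show "{v. \<exists>\<mu>. lowering v \<mu>} \<subseteq> ?S"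
    proof clarify
      fix v \<mu>
      assume "lowering v \<mu>"
      then show "\<exists>F f. finite F \<and> (\<forall>\<mu>. f \<mu> \<in> weight_space V act \<mu>) \<and>
          (\<forall>\<mu>. \<mu> \<notin> F \<longrightarrow> f \<mu> = 0) \<and> v = (\<Sum>\<mu>\<in>F. f \<mu>)"
        by (intro exI[of _ "{\<mu>}"] exI[of _ "\<lambda>\<nu>. if \<nu> = \<mu> then v else 0"])
          (auto simp: lowering_weight_space closed)
    qed
    show "complex_vector.subspace ?S"
    proof (rule complex_vector.subspaceI)
      show "0 \<in> ?S"
        by (auto intro!: exI[of _ "{}"] exI[of _ "\<lambda>_. 0"] closed)
      fix x y
      assume "x \<in> ?S" "y \<in> ?S"
      then obtain F f G g where
        f: "finite F" "\<forall>\<mu>. f \<mu> \<in> weight_space V act \<mu>" "\<forall>\<mu>. \<mu> \<notin> F \<longrightarrow> f \<mu> = 0" "x = (\<Sum>\<mu>\<in>F. f \<mu>)"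
        and g: "finite G" "\<forall>\<mu>. g \<mu> \<in> weight_space V act \<mu>" "\<forall>\<mu>. \<mu> \<notin> G \<longrightarrow> g \<mu> = 0" "y = (\<Sum>\<mu>\<in>G. g \<mu>)"
        by auto
      have "x = (\<Sum>\<mu>\<in>F \<union> G. f \<mu>)" "y = (\<Sum>\<mu>\<in>F \<union> G. g \<mu>)"
        unfolding f(4) g(4) using f(1,3) g(1,3) by (auto intro!: sum.mono_neutral_left)
      then have "x + y = (\<Sum>\<mu>\<in>F \<union> G. f \<mu> + g \<mu>)"
        by (simp add: sum.distrib)
      then show "x + y \<in> ?S"
        using f g by (intro CollectI exI[of _ "F \<union> G"] exI[of _ "\<lambda>\<mu>. f \<mu> + g \<mu>"])
          (auto intro: closed)
    next
      fix c x
      assume "x \<in> ?S"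
      then obtain F f where
        f: "finite F" "\<forall>\<mu>. f \<mu> \<in> weight_space V act \<mu>" "\<forall>\<mu>. \<mu> \<notin> F \<longrightarrow> f \<mu> = 0" "x = (\<Sum>\<mu>\<in>F. f \<mu>)"
        by auto
      then show "c *\<^sub>C x \<in> ?S"
        by (intro CollectI exI[of _ F] exI[of _ "\<lambda>\<mu>. c *\<^sub>C f \<mu>"])
          (auto intro: closed simp: complex_vector.scale_sum_right)
    qed
  qed
  with assms span_lowering obtain F f where f: "finite F" "\<forall>\<mu>. f \<mu> \<in> weight_space V act \<mu>" "y = (\<Sum>\<mu>\<in>F. f \<mu>)"
    by auto
  have "f \<mu> = 0" if "\<mu> \<notin> weights V act" for \<mu>
    using f(2) that by (auto simp: weights_def)
  then have "y = (\<Sum>\<mu>\<in>F \<inter> weights V act. f \<mu>)"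
    unfolding f(3) by (intro sum.mono_neutral_right f(1)) auto
  with f that[of "F \<inter> weights V act" f] show thesis
    by auto
qed

end

section \<open>Energies of weights\<close>

lemma character_superset:
  assumes "finite I" "\<And>i. \<gamma> i \<noteq> 0 \<Longrightarrow> i \<in> I"
  shows "character e B \<gamma> = (\<Sum>i\<in>I. of_int (\<gamma> i) * diag_entry e B i)"
  unfolding character_def by (rule sum.mono_neutral_left) (use assms in auto)

context unitary_highest_weight_module
begin

text \<open>Each step raises the energy by a difference of entries that \<open>mono\<close> makes
  non-negative. Finite support is carried along because \<open>character\<close> sums over the
  support, and a sum over an infinite set would collapse to 0.\<close>

lemma lowering_cone:
  assumes "lowering v \<mu>"
    and mono: "\<And>j k. lam k < lam j \<Longrightarrow> diag_entry e B j \<le> diag_entry e B k"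
  shows "finite {i. \<mu> i \<noteq> lam i} \<and> 0 \<le> character e B (\<lambda>i. \<mu> i - lam i)"
  using assms(1)
proof induction
  case lowering_hw
  then show ?case
    by (simp add: character_def)
next
  case (lowering_act v \<mu> k j)
  let ?\<gamma> = "\<lambda>i. \<mu> i - lam i" and ?I = "{i. \<mu> i \<noteq> lam i} \<union> {j, k}"
  have fin: "finite ?I"
    using lowering_act.IH by simp
  have "{i. \<mu> i + root k j i \<noteq> lam i} \<subseteq> ?I"
    by (auto simp: root_def split: if_splits)
  with fin have fin': "finite {i. \<mu> i + root k j i \<noteq> lam i}"
    by (rule rev_finite_subset)
  have "character e B (\<lambda>i. \<mu> i + root k j i - lam i)
      = (\<Sum>i\<in>?I. of_int (\<mu> i + root k j i - lam i) * diag_entry e B i)"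
    by (rule character_superset[OF fin]) (auto simp: root_def split: if_splits)
  also have "\<dots> = (\<Sum>i\<in>?I. of_int (?\<gamma> i) * diag_entry e B i)
      + (\<Sum>i\<in>?I. of_int (root k j i) * diag_entry e B i)"
    unfolding sum.distrib[symmetric] distrib_right[symmetric] by (intro sum.cong) simp_all
  also have "(\<Sum>i\<in>?I. of_int (?\<gamma> i) * diag_entry e B i) = character e B ?\<gamma>"
    by (rule character_superset[OF fin, symmetric]) auto
  also have "(\<Sum>i\<in>?I. of_int (root k j i) * diag_entry e B i)
      = (\<Sum>i\<in>{j, k}. of_int (root k j i) * diag_entry e B i)"
    by (rule sum.mono_neutral_right[OF fin]) (auto simp: root_def)
  also have "\<dots> = diag_entry e B k - diag_entry e B j"
    using lowering_act.hyps(2) by (cases "j = k") (auto simp: root_def)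
  finally show ?case
    using lowering_act.IH mono[OF lowering_act.hyps(2)] fin' by linarith
qed

lemma weights_finite_support:
  assumes "\<mu> \<in> weights V act"
  shows "finite {i. \<mu> i \<noteq> lam i}"
proof -
  obtain v where "lowering v \<mu>"
    using assms by (rule weights_lowering)
  then show ?thesis
  proof induction
    case (lowering_act v \<mu> k j)
    have "{i. \<mu> i + root k j i \<noteq> lam i} \<subseteq> {i. \<mu> i \<noteq> lam i} \<union> {j, k}"
      by (auto simp: root_def split: if_splits)
    then show ?case
      by (rule finite_subset) (simp add: lowering_act.IH)
  qed simp
qed

lemma character_weights_nonneg:
  assumes "\<mu> \<in> weights V act"
    and "\<And>j k. lam k < lam j \<Longrightarrow> diag_entry e B j \<le> diag_entry e B k"
  shows "0 \<le> character e B (\<lambda>i. \<mu> i - lam i)"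
  using weights_lowering[OF assms(1)] lowering_cone assms(2) by metis

text \<open>The energy paid for an exchange. The two occurrences of \<open>lam i\<close> are left
  uncancelled to match the weight produced by \<open>weight_exchange\<close>.\<close>

lemma character_exchange:
  assumes "finite F" "finite G" "\<And>k j. k \<in> F \<Longrightarrow> j \<in> G \<Longrightarrow> lam k < lam j"
  shows "character e B (\<lambda>i. lam i + of_bool (i \<in> F) - of_bool (i \<in> G) - lam i)
    = (\<Sum>k\<in>F. diag_entry e B k) - (\<Sum>j\<in>G. diag_entry e B j)"
proof -
  have "character e B (\<lambda>i. lam i + of_bool (i \<in> F) - of_bool (i \<in> G) - lam i)
      = (\<Sum>i\<in>F \<union> G. of_int (lam i + of_bool (i \<in> F) - of_bool (i \<in> G) - lam i) * diag_entry e B i)"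
    by (rule character_superset) (use assms in \<open>auto split: if_splits\<close>)
  also have "\<dots> = (\<Sum>i\<in>F \<union> G. of_bool (i \<in> F) * diag_entry e B i)
      - (\<Sum>i\<in>F \<union> G. of_bool (i \<in> G) * diag_entry e B i)"
    by (simp add: sum_subtractf[symmetric] left_diff_distrib[symmetric])
  also have "(\<Sum>i\<in>F \<union> G. of_bool (i \<in> F) * diag_entry e B i) = (\<Sum>i\<in>F. diag_entry e B i)"
    by (rule sum.mono_neutral_cong_right) (use assms in auto)
  also have "(\<Sum>i\<in>F \<union> G. of_bool (i \<in> G) * diag_entry e B i) = (\<Sum>i\<in>G. diag_entry e B i)"
    by (rule sum.mono_neutral_cong_right) (use assms in auto)
  finally show ?thesis .
qed

end

section \<open>Summable antitone approximation\<close>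

text \<open>The indices of a finite set in \<open>Q\<close> with entries below \<open>m\<close> are
  matched with equally many indices in \<open>P\<close> whose entries nearly reach \<open>m\<close>;
  the infinite supply makes this possible for every size. The exchange bound then controls the total
  deficit.\<close>

lemma summable_below_threshold:
  fixes d :: "'j \<Rightarrow> real"
  assumes exchange: "\<And>F G. finite F \<Longrightarrow> F \<subseteq> Q \<Longrightarrow> finite G \<Longrightarrow> G \<subseteq> P \<Longrightarrow> card F = card G \<Longrightarrow>
      sum d G - sum d F \<le> C"
    and infinite: "\<And>\<epsilon>. \<epsilon> > 0 \<Longrightarrow> infinite {j \<in> P. m - \<epsilon> < d j}"
  shows "(\<lambda>k. max 0 (m - d k)) summable_on Q"
proof (rule nonneg_bdd_above_summable_on)
  show "bdd_above (sum (\<lambda>k. max 0 (m - d k)) ` {F. F \<subseteq> Q \<and> finite F})"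
  proof (rule bdd_aboveI2)
    fix F
    assume F: "F \<in> {F. F \<subseteq> Q \<and> finite F}"
    define F' where "F' = {k \<in> F. d k < m}"
    define N where "N = card F'"
    \<comment> \<open>Adapted to the size of the set: the \<open>N\<close> matched entries miss
      \<open>m\<close> by at most \<open>N * \<epsilon> \<le> 1\<close> in total, so
      \<open>C + 1\<close> bounds all finite sums at once.\<close>
    define \<epsilon> where "\<epsilon> = 1 / (real N + 1)"
    have \<epsilon>: "\<epsilon> > 0" "real N * \<epsilon> \<le> 1"
      by (simp_all add: \<epsilon>_def)
    obtain G where G: "finite G" "card G = N" "G \<subseteq> {j \<in> P. m - \<epsilon> < d j}"
      using infinite_arbitrarily_large[OF infinite[OF \<epsilon>(1)]] by metis
    have "real N * (m - \<epsilon>) \<le> sum d G"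
      using sum_bounded_below[of G "m - \<epsilon>" d] G by (auto simp: subset_iff less_imp_le)
    moreover have "sum d G - sum d F' \<le> C"
      using F G by (intro exchange) (auto simp: F'_def N_def)
    moreover have "(\<Sum>k\<in>F. max 0 (m - d k)) = (\<Sum>k\<in>F'. m - d k)"
      using F by (intro sum.mono_neutral_cong_right) (auto simp: F'_def)
    then have "(\<Sum>k\<in>F. max 0 (m - d k)) = real N * m - sum d F'"
      by (simp add: sum_subtractf N_def)
    ultimately show "(\<Sum>k\<in>F. max 0 (m - d k)) \<le> C + 1"
      using \<epsilon>(2) by (simp add: right_diff_distrib)
  qed
qed simp

text \<open>Negating \<open>d\<close> interchanges the roles of \<open>P\<close> and
  \<open>Q\<close>.\<close>

lemma summable_above_threshold:
  fixes d :: "'j \<Rightarrow> real"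
  assumes exchange: "\<And>F G. finite F \<Longrightarrow> F \<subseteq> Q \<Longrightarrow> finite G \<Longrightarrow> G \<subseteq> P \<Longrightarrow> card F = card G \<Longrightarrow>
      sum d G - sum d F \<le> C"
    and infinite: "\<And>\<epsilon>. \<epsilon> > 0 \<Longrightarrow> infinite {k \<in> Q. d k < m + \<epsilon>}"
  shows "(\<lambda>j. max 0 (d j - m)) summable_on P"
proof -
  have "(\<lambda>j. max 0 (- m - - d j)) summable_on P"
  proof (rule summable_below_threshold[where P = Q and C = C])
    show "sum (\<lambda>j. - d j) G - sum (\<lambda>j. - d j) F \<le> C"
      if "finite F" "F \<subseteq> P" "finite G" "G \<subseteq> Q" "card F = card G" for F G
      using exchange[of G F] that by (simp add: sum_negf)
    show "infinite {j \<in> Q. - m - \<epsilon> < - d j}" if "\<epsilon> > 0" for \<epsilon>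
      using infinite[OF that] by (simp add: algebra_simps)
  qed
  then show ?thesis by simp
qed

lemma summable_max_mono:
  fixes f g :: "'j \<Rightarrow> real"
  assumes "(\<lambda>j. max 0 (g j)) summable_on A" "B \<subseteq> A" "\<And>j. j \<in> B \<Longrightarrow> f j \<le> g j"
  shows "(\<lambda>j. max 0 (f j)) summable_on B"
  by (rule summable_on_comparison_test[OF summable_on_subset_banach[OF assms(1,2)]])
    (use assms(3) in force)+

lemma summable_max_finite:
  fixes f :: "'j \<Rightarrow> real"
  assumes "finite {j \<in> A. 0 < f j}"
  shows "(\<lambda>j. max 0 (f j)) summable_on A"
  by (rule finite_nonzero_values_imp_summable_on, rule rev_finite_subset[OF assms]) auto

text \<open>The threshold is found near the infimum of all \<open>m\<close> for which the part of \<open>d\<close> above \<open>m\<close> is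
  summable on \<open>P\<close>.\<close>

lemma exists_threshold:
  fixes d :: "'j \<Rightarrow> real"
  assumes exchange: "\<And>F G. finite F \<Longrightarrow> F \<subseteq> Q \<Longrightarrow> finite G \<Longrightarrow> G \<subseteq> P \<Longrightarrow> card F = card G \<Longrightarrow>
      sum d G - sum d F \<le> C"
    and bound: "\<And>j. \<bar>d j\<bar> \<le> B"
  shows "\<exists>m. (\<lambda>j. max 0 (d j - m)) summable_on P \<and> (\<lambda>k. max 0 (m - d k)) summable_on Q"
proof -
  define U where "U = {m. (\<lambda>j. max 0 (d j - m)) summable_on P}"
  have up: "m' \<in> U" if "m \<in> U" "m \<le> m'" for m m'
    using that(1) unfolding U_def mem_Collect_eq
    by (rule summable_max_mono[OF _ order_refl]) (use that(2) in simp)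
  have "\<not> 0 < d j - B" for j
    using bound[of j] by linarith
  then have "finite {j \<in> P. 0 < d j - B}"
    by simp
  then have "B \<in> U"
    unfolding U_def mem_Collect_eq by (rule summable_max_finite)
  show ?thesis
  proof (cases "bdd_below U")
    case True
    define m where "m = Inf U"
    have below: "(\<lambda>k. max 0 (m - d k)) summable_on Q"
    proof (rule summable_below_threshold[where P = P and C = C])
      show "sum d G - sum d F \<le> C"
        if "finite F" "F \<subseteq> Q" "finite G" "G \<subseteq> P" "card F = card G" for F G
        using that by (rule exchange)
      fix \<epsilon> :: real
      assume "\<epsilon> > 0"
      show "infinite {j \<in> P. m - \<epsilon> < d j}"
      proof
        assume "finite {j \<in> P. m - \<epsilon> < d j}"
        then have "finite {j \<in> P. 0 < d j - (m - \<epsilon>)}"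
          by simp
        then have "m - \<epsilon> \<in> U"
          unfolding U_def mem_Collect_eq by (rule summable_max_finite)
        then have "m \<le> m - \<epsilon>"
          unfolding m_def using True by (rule cInf_lower)
        with \<open>\<epsilon> > 0\<close> show False by simp
      qed
    qed
    show ?thesis
    proof (cases "m \<in> U")
      case True
      then have "(\<lambda>j. max 0 (d j - m)) summable_on P"
        by (simp only: U_def mem_Collect_eq)
      with below show ?thesis
        by (intro exI conjI)
    next
      case False
      \<comment> \<open>\<open>U\<close> need not contain its infimum. If \<open>m\<close> fails,
        entries on \<open>Q\<close> cannot accumulate at or below \<open>m\<close>, and some
        \<open>m + \<epsilon>\<close> serves instead: it belongs to \<open>U\<close>, and only
        finitely many entries on \<open>Q\<close> lie below it.\<close>
      have "\<exists>\<epsilon>>0. finite {k \<in> Q. d k < m + \<epsilon>}"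
      proof (rule ccontr)
        assume "\<not> ?thesis"
        then have "infinite {k \<in> Q. d k < m + \<epsilon>}" if "\<epsilon> > 0" for \<epsilon>
          using that by blast
        with exchange have "(\<lambda>j. max 0 (d j - m)) summable_on P"
          by (rule summable_above_threshold)
        then have "m \<in> U"
          by (simp only: U_def mem_Collect_eq)
        with False show False ..
      qed
      then obtain \<epsilon> where \<epsilon>: "\<epsilon> > 0" "finite {k \<in> Q. d k < m + \<epsilon>}"
        by blast
      obtain u where "u \<in> U" "u < m + \<epsilon>"
        using cInf_lessD[of U "m + \<epsilon>"] \<open>B \<in> U\<close> \<epsilon>(1) unfolding m_def by force
      then have "m + \<epsilon> \<in> U"
        using up[of u] by simp
      then have "(\<lambda>j. max 0 (d j - (m + \<epsilon>))) summable_on P"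
        by (simp only: U_def mem_Collect_eq)
      moreover have "(\<lambda>k. max 0 (m + \<epsilon> - d k)) summable_on Q"
        by (rule summable_max_finite) (use \<epsilon>(2) in simp)
      ultimately show ?thesis
        by (intro exI conjI)
    qed
  next
    case False
    \<comment> \<open>Here \<open>U\<close> contains every real number, for instance when
      \<open>P\<close> is finite. The choice \<open>- B\<close> is convenient because no entry lies
      below it.\<close>
    have "\<exists>u\<in>U. u < - B"
    proof (rule ccontr)
      assume "\<not> ?thesis"
      then have "bdd_below U"
        by (meson bdd_belowI not_less)
      with False show False ..
    qed
    then obtain u where "u \<in> U" "u < - B" ..
    then have "- B \<in> U"
      using up[of u] by simp
    then have "(\<lambda>j. max 0 (d j - - B)) summable_on P"
      by (simp only: U_def mem_Collect_eq)
    moreover have "\<not> 0 < - B - d k" for k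
      using bound[of k] by linarith
    then have "finite {k \<in> Q. 0 < - B - d k}"
      by simp
    then have "(\<lambda>k. max 0 (- B - d k)) summable_on Q"
      by (rule summable_max_finite)
    ultimately show ?thesis
      by (intro exI conjI)
  qed
qed

lemma summable_on_finite_levels:
  fixes f :: "'j \<Rightarrow> real" and l :: "'j \<Rightarrow> int"
  assumes "\<And>j. \<bar>l j\<bar> \<le> N" "\<And>n. n \<le> N \<Longrightarrow> f summable_on {j. l j = n}"
  shows "f summable_on UNIV"
proof -
  have "f summable_on (\<Union>n\<in>{- N..N}. {j. l j = n})"
    by (rule summable_on_finite_union_disjoint) (use assms(2) in auto)
  moreover have "(\<Union>n\<in>{- N..N}. {j. l j = n}) = UNIV"
    using assms(1) by (auto simp: abs_le_iff minus_le_iff)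
  ultimately show ?thesis
    by simp
qed

lemma antitone_summable_approximation:
  fixes d :: "'j \<Rightarrow> real" and l :: "'j \<Rightarrow> int"
  assumes exchange: "\<And>F G. finite F \<Longrightarrow> finite G \<Longrightarrow> card F = card G \<Longrightarrow>
      (\<And>k j. k \<in> F \<Longrightarrow> j \<in> G \<Longrightarrow> l k < l j) \<Longrightarrow> sum d G - sum d F \<le> C"
    and bound: "\<And>j. \<bar>d j\<bar> \<le> B" and l: "\<And>j. \<bar>l j\<bar> \<le> N"
  obtains a where "\<And>j k. l k < l j \<Longrightarrow> a j \<le> a k" "(\<lambda>j. \<bar>d j - a j\<bar>) summable_on UNIV"
proof -
  have "\<exists>m. (\<lambda>j. max 0 (d j - m)) summable_on {j. n < l j} \<and>
      (\<lambda>k. max 0 (m - d k)) summable_on {k. l k \<le> n}" for n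
  proof (rule exists_threshold[where C = C, OF _ bound])
    show "sum d G - sum d F \<le> C"
      if "finite F" "F \<subseteq> {k. l k \<le> n}" "finite G" "G \<subseteq> {j. n < l j}" "card F = card G" for F G
      using that by (intro exchange) fastforce+
  qed
  then obtain m where above: "(\<lambda>j. max 0 (d j - m n)) summable_on {j. n < l j}"
    and below: "(\<lambda>k. max 0 (m n - d k)) summable_on {k. l k \<le> n}" for n
    by metis
  \<comment> \<open>The running maximum makes the thresholds antitone in the level. Raising a
    threshold preserves summability above it; summability below is inherited from the level
    \<open>i \<ge> n\<close> at which the maximum is attained, since its index set is larger. For
    \<open>n \<le> N\<close> the range is nonempty.\<close>
  define M where "M n = Max (m ` {n..N})" for n
  have M_antimono: "M n' \<le> M n" if "n \<le> n'" "n' \<le> N" for n n'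
    unfolding M_def using that by (intro Max_mono) auto
  have M_above: "(\<lambda>j. max 0 (d j - M n)) summable_on {j. n < l j}" if "n \<le> N" for n
  proof (rule summable_max_mono[OF above order_refl])
    have "m n \<le> M n"
      unfolding M_def using that by (intro Max_ge) auto
    then show "d j - M n \<le> d j - m n" for j
      by simp
  qed
  have M_below: "(\<lambda>k. max 0 (M n - d k)) summable_on {k. l k \<le> n}" if "n \<le> N" for n
  proof -
    have "M n \<in> m ` {n..N}"
      unfolding M_def using that by (intro Max_in) auto
    then obtain i where "n \<le> i" "M n = m i"
      by auto
    then show ?thesis
      by (auto intro!: summable_max_mono[OF below[of i]])
  qed
  have lN: "l j \<le> N" for j
    using l[of j] by simp
  \<comment> \<open>An index at level \<open>n\<close> lies on the upper side of the cut at
    \<open>n\<close> - 1 and on the lower side of the cut at \<open>n\<close>, in the order of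
    \<open>l\<close>. So its entry should lie between \<open>M n\<close> and
    \<open>M (n - 1)\<close>. Intervals of consecutive levels share only an end point, which makes
    \<open>a\<close> antitone.\<close>
  define a where "a j = min (M (l j - 1)) (max (M (l j)) (d j))" for j
  show thesis
  proof
    show "a j \<le> a k" if "l k < l j" for j k
    proof -
      have "a j \<le> M (l j - 1)" "M (l k) \<le> a k"
        using M_antimono[of "l k - 1" "l k"] lN[of k] by (auto simp: a_def)
      moreover have "M (l j - 1) \<le> M (l k)"
        using that lN[of j] by (intro M_antimono) auto
      ultimately show ?thesis by simp
    qed
    have "(\<lambda>j. max 0 (M (l j) - d j)) summable_on UNIV"
    proof (rule summable_on_finite_levels[OF l])
      fix n
      assume "n \<le> N"
      show "(\<lambda>j. max 0 (M (l j) - d j)) summable_on {j. l j = n}"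
        by (rule summable_max_mono[OF M_below[OF \<open>n \<le> N\<close>]]) auto
    qed
    moreover have "(\<lambda>j. max 0 (d j - M (l j - 1))) summable_on UNIV"
    proof (rule summable_on_finite_levels[OF l])
      fix n
      assume "n \<le> N"
      then have "n - 1 \<le> N" by simp
      show "(\<lambda>j. max 0 (d j - M (l j - 1))) summable_on {j. l j = n}"
        by (rule summable_max_mono[OF M_above[OF \<open>n - 1 \<le> N\<close>]]) auto
    qed
    ultimately have "(\<lambda>j. max 0 (M (l j) - d j) + max 0 (d j - M (l j - 1))) summable_on UNIV"
      by (rule summable_on_add)
    then show "(\<lambda>j. \<bar>d j - a j\<bar>) summable_on UNIV"
    proof (rule summable_on_comparison_test)
      show "\<bar>d j - a j\<bar> \<le> max 0 (M (l j) - d j) + max 0 (d j - M (l j - 1))" for j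
        using M_antimono[of "l j - 1" "l j"] lN[of j] by (auto simp: a_def)
    qed simp
  qed
qed

section \<open>One-parameter groups with given weights\<close>

lemma unitary_opD:
  assumes "unitary_op u"
  shows "bounded_clinear u" "cinner (u x) (u y) = cinner x y" "norm (u x) = norm x"
proof -
  show "bounded_clinear u" "cinner (u x) (u y) = cinner x y" for y
    using assms by (simp_all add: unitary_op_def)
  from this(2)[of x] have "(norm (u x))\<^sup>2 = (norm x)\<^sup>2"
    by (metis Re_cinner_self)
  then show "norm (u x) = norm x"
    by (simp add: power2_eq_iff_nonneg)
qed

lemma unitary_op_compose: "unitary_op u \<Longrightarrow> unitary_op w \<Longrightarrow> unitary_op (\<lambda>x. u (w x))"
  using comp_surj[of w u] by (auto simp: unitary_op_def bounded_clinear_compose o_def)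

lemma unitary_op_phase:
  assumes "unitary_op u"
  shows "unitary_op (\<lambda>x. cis a *\<^sub>C u x)"
  unfolding unitary_op_def
proof (intro conjI allI)
  show "surj (\<lambda>x. cis a *\<^sub>C u x)"
    unfolding surj_def
  proof
    fix y
    obtain x where "u x = cis (- a) *\<^sub>C y"
      using assms by (metis unitary_op_def surjE)
    then show "\<exists>x. y = cis a *\<^sub>C u x"
      by (intro exI[of _ x]) (simp add: scaleC_scaleC cis_mult)
  qed
  show "cinner (cis a *\<^sub>C u x) (cis a *\<^sub>C u y) = cinner x y" for x y
    by (simp add: cinner_scaleC_left cinner_scaleC_right unitary_opD[OF assms] cis_cnj cis_mult
        flip: mult.assoc)
qed (intro bounded_clinear_scaleC unitary_opD(1) assms)

lemma bounded_selfadjoint_sub: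
  "bounded_selfadjoint S \<Longrightarrow> bounded_selfadjoint T \<Longrightarrow> bounded_selfadjoint (\<lambda>x. S x - T x)"
  by (auto simp: bounded_selfadjoint_def bounded_clinear_sub cinner_diff_left cinner_diff_right)

lemma norm_orthogonal_sum:
  assumes "finite F" "\<And>a b. a \<in> F \<Longrightarrow> b \<in> F \<Longrightarrow> a \<noteq> b \<Longrightarrow> cinner (f a) (f b) = 0"
  shows "(norm (\<Sum>a\<in>F. f a))\<^sup>2 = (\<Sum>a\<in>F. (norm (f a :: 'a::chilbert_space))\<^sup>2)"
proof -
  have "cinner (\<Sum>a\<in>F. f a) (\<Sum>a\<in>F. f a) = (\<Sum>a\<in>F. \<Sum>b\<in>F. cinner (f a) (f b))"
    by (subst cinner_sum_left) (simp add: cinner_sum_right)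
  also have "\<dots> = (\<Sum>a\<in>F. \<Sum>b\<in>F. if a = b then cinner (f a) (f a) else 0)"
    using assms(2) by (intro sum.cong refl) auto
  also have "\<dots> = (\<Sum>a\<in>F. cinner (f a) (f a))"
    using assms(1) by simp
  finally show ?thesis
    by (metis (mono_tags, lifting) Re_cinner_self Re_sum sum.cong)
qed

lemma le_zero_if_multiples_bounded: "(\<And>r. r > 0 \<Longrightarrow> r * x \<le> K) \<Longrightarrow> x \<le> 0" for x :: real
proof (rule ccontr)
  assume *: "\<And>r. r > 0 \<Longrightarrow> r * x \<le> K" and "\<not> x \<le> 0"
  then have "(\<bar>K\<bar> + 1) / x * x \<le> K"
    by (intro *) simp
  with \<open>\<not> x \<le> 0\<close> show False by simp
qed

text \<open>\<open>group_hom\<close> includes the group axioms of its source, so the semidirect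
  product for the perturbed action must itself be shown to be a group.\<close>

lemma group_semidirect:
  fixes G (structure)
  assumes "group G" and closed: "\<And>s h. h \<in> carrier G \<Longrightarrow> \<alpha> s h \<in> carrier G"
    and mult: "\<And>s h k. h \<in> carrier G \<Longrightarrow> k \<in> carrier G \<Longrightarrow> \<alpha> s (h \<otimes> k) = \<alpha> s h \<otimes> \<alpha> s k"
    and one: "\<And>s. \<alpha> s \<one> = \<one>" and zero: "\<And>h. h \<in> carrier G \<Longrightarrow> \<alpha> 0 h = h"
    and add: "\<And>s t h. h \<in> carrier G \<Longrightarrow> \<alpha> (s + t) h = \<alpha> s (\<alpha> t h)"
  shows "group (semidirect G \<alpha>)"
proof (rule groupI)
  interpret group G by fact
  show "x \<otimes>\<^bsub>semidirect G \<alpha>\<^esub> y \<in> carrier (semidirect G \<alpha>)"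
    if "x \<in> carrier (semidirect G \<alpha>)" "y \<in> carrier (semidirect G \<alpha>)" for x y
    using that by (auto simp: semidirect_def closed)
  show "\<one>\<^bsub>semidirect G \<alpha>\<^esub> \<in> carrier (semidirect G \<alpha>)"
    by (simp add: semidirect_def)
  show "x \<otimes>\<^bsub>semidirect G \<alpha>\<^esub> y \<otimes>\<^bsub>semidirect G \<alpha>\<^esub> z
      = x \<otimes>\<^bsub>semidirect G \<alpha>\<^esub> (y \<otimes>\<^bsub>semidirect G \<alpha>\<^esub> z)"
    if "x \<in> carrier (semidirect G \<alpha>)" "y \<in> carrier (semidirect G \<alpha>)"
      "z \<in> carrier (semidirect G \<alpha>)" for x y z
    using that by (auto simp: semidirect_def closed mult add m_assoc)
  show "\<one>\<^bsub>semidirect G \<alpha>\<^esub> \<otimes>\<^bsub>semidirect G \<alpha>\<^esub> x = x"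
    if "x \<in> carrier (semidirect G \<alpha>)" for x
    using that by (auto simp: semidirect_def zero)
  show "\<exists>y\<in>carrier (semidirect G \<alpha>). y \<otimes>\<^bsub>semidirect G \<alpha>\<^esub> x = \<one>\<^bsub>semidirect G \<alpha>\<^esub>"
    if mem: "x \<in> carrier (semidirect G \<alpha>)" for x
  proof -
    obtain g s where x: "x = (g, s)" "g \<in> carrier G"
      using mem by (cases x) (auto simp: semidirect_def)
    then have "\<alpha> (- s) (inv g) \<otimes> \<alpha> (- s) g = \<one>"
      by (simp add: one flip: mult)
    with x show ?thesis
      by (intro bexI[of _ "(\<alpha> (- s) (inv g), - s)"]) (auto simp: semidirect_def closed)
  qed
qed

lemma has_vector_derivative_cis:
  "((\<lambda>t. cis (t * \<eta>) *\<^sub>C v) has_vector_derivative \<i> *\<^sub>C (complex_of_real \<eta> *\<^sub>C v)) (at 0)"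
  for v :: "'a::chilbert_space"
proof -
  have "((\<lambda>z. exp (\<i> * of_real \<eta> * z)) has_field_derivative \<i> * of_real \<eta>) (at (of_real 0))"
    by (auto intro!: derivative_eq_intros)
  from has_vector_derivative_real_field[OF this]
  have "((\<lambda>t. cis (t * \<eta>)) has_vector_derivative \<i> * of_real \<eta>) (at 0)"
    by (simp add: cis_conv_exp mult_ac)
  from bounded_linear.has_vector_derivative[OF bounded_linear_scaleC_left this, of v]
  show ?thesis
    by (simp add: scaleC_scaleC)
qed

section \<open>Weight flows and their Hamiltonians\<close>

context unitary_highest_weight_module
begin

lemma weight_vector_induct:
  assumes "y \<in> V" "P 0" "\<And>x y. P x \<Longrightarrow> P y \<Longrightarrow> P (x + y)" "\<And>c x. P x \<Longrightarrow> P (c *\<^sub>C x)"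
    and "\<And>\<mu> v. \<mu> \<in> weights V act \<Longrightarrow> v \<in> weight_space V act \<mu> \<Longrightarrow> P v"
  shows "P y"
proof -
  have "V \<subseteq> {y. P y}"
    unfolding span_lowering[symmetric]
  proof (rule complex_vector.span_minimal)
    show "{v. \<exists>\<mu>. lowering v \<mu>} \<subseteq> {y. P y}"
    proof clarify
      fix v \<mu>
      assume "lowering v \<mu>"
      then have "v \<in> weight_space V act \<mu>"
        by (rule lowering_weight_space)
      \<comment> \<open>A lowering monomial may vanish, and then its label need not be a
        weight.\<close>
      then show "P v"
        using assms(2) assms(5)[of \<mu> v] by (cases "v = 0") (auto simp: weights_def)
    qed
  qed (use assms in \<open>auto intro!: complex_vector.subspaceI\<close>)
  with assms(1) show ?thesis by blast
qed

lemma eq_on_weight_vectors: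
  assumes "closure V = UNIV" "bounded_clinear S" "bounded_clinear T"
    and "\<And>\<mu> v. \<mu> \<in> weights V act \<Longrightarrow> v \<in> weight_space V act \<mu> \<Longrightarrow> S v = T v"
  shows "S = T"
proof (rule bounded_clinear_eqI[of V])
  show "closure (complex_vector.span V) = UNIV"
    using assms(1) by (simp add: complex_vector.span_eq_iff[THEN iffD2, OF subspace])
  fix y
  assume "y \<in> V"
  then show "S y = T y"
    by (rule weight_vector_induct)
      (simp_all add: assms(4) bounded_clinearD[OF assms(2)] bounded_clinearD[OF assms(3)])
qed (fact assms)+

lemma weight_flowD:
  assumes "is_weight_flow e lam V act B U"
  shows "unitary_op (U t)"
    and "\<mu> \<in> weights V act \<Longrightarrow> v \<in> weight_space V act \<mu> \<Longrightarrow>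
      U t v = cis (t * character e B (\<lambda>j. \<mu> j - lam j)) *\<^sub>C v"
  using assms by (auto simp: is_weight_flow_def)

text \<open>\<open>is_weight_flow\<close> prescribes unitarity and the values on weight vectors; the
  laws of a one-parameter group follow from density of \<open>V\<close>.\<close>

lemma weight_flow_zero:
  assumes "closure V = UNIV" "is_weight_flow e lam V act B U"
  shows "U 0 = id"
  unfolding id_def
  by (rule eq_on_weight_vectors[OF assms(1) unitary_opD(1)[OF weight_flowD(1)[OF assms(2)]]
        bounded_clinear_id])
    (simp add: weight_flowD(2)[OF assms(2)])

lemma weight_flow_add:
  assumes "closure V = UNIV" and U: "is_weight_flow e lam V act B U"
  shows "U (s + t) = (\<lambda>v. U s (U t v))"
proof (rule eq_on_weight_vectors[OF assms(1)])
  note linear = unitary_opD(1)[OF weight_flowD(1)[OF U]]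
  show "bounded_clinear (U (s + t))" "bounded_clinear (\<lambda>v. U s (U t v))"
    using linear bounded_clinear_compose[OF linear linear] by blast+
  show "U (s + t) v = U s (U t v)" if "\<mu> \<in> weights V act" "v \<in> weight_space V act \<mu>" for \<mu> v
    by (simp add: weight_flowD(2)[OF U that] bounded_clinearD(2)[OF linear] scaleC_scaleC cis_mult
        distrib_right add.commute)
qed

text \<open>Clear on \<open>V\<close>, where finitely many phases are involved. Since all
  \<open>U t\<close> are isometric, an approximation by \<open>y \<in> V\<close> is uniform in
  \<open>t\<close> and costs two thirds of \<open>\<epsilon>\<close>.\<close>

lemma weight_flow_continuous:
  assumes "closure V = UNIV" and U: "is_weight_flow e lam V act B U"
  shows "isCont (\<lambda>t. U t v) t"
  unfolding continuous_at_eps_delta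
proof (intro allI impI)
  note linear = bounded_clinearD[OF unitary_opD(1)[OF weight_flowD(1)[OF U]]]
  have V: "isCont (\<lambda>t. U t y) t" if "y \<in> V" for y
    using that
  proof (rule weight_vector_induct)
    show "isCont (\<lambda>t. U t (x + y)) t" if "isCont (\<lambda>t. U t x) t" "isCont (\<lambda>t. U t y) t" for x y
      using that by (simp add: linear)
    show "isCont (\<lambda>t. U t (c *\<^sub>C x)) t" if "isCont (\<lambda>t. U t x) t" for c x
      using bounded_linear.isCont[OF bounded_linear_scaleC_right that] by (simp add: linear)
    show "isCont (\<lambda>t. U t v) t" if "\<mu> \<in> weights V act" "v \<in> weight_space V act \<mu>" for \<mu> v
      unfolding weight_flowD(2)[OF U that]
      by (intro bounded_linear.isCont[OF bounded_linear_scaleC_left]) (simp add: cis_conv_exp)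
  qed (simp add: linear)
  fix \<epsilon> :: real
  assume "\<epsilon> > 0"
  then obtain y where y: "y \<in> V" "norm (v - y) < \<epsilon> / 3"
    using assms(1) closure_approachable[of v V]
    by (metis UNIV_I dist_commute dist_norm zero_less_divide_iff zero_less_numeral)
  obtain \<delta> where \<delta>: "\<delta> > 0" "\<And>s. dist s t < \<delta> \<Longrightarrow> dist (U s y) (U t y) < \<epsilon> / 3"
    using V[OF y(1)] \<open>\<epsilon> > 0\<close> unfolding continuous_at_eps_delta
    by (metis zero_less_divide_iff zero_less_numeral)
  show "\<exists>\<delta>>0. \<forall>s. dist s t < \<delta> \<longrightarrow> dist (U s v) (U t v) < \<epsilon>"
  proof (intro exI[of _ \<delta>] conjI allI impI \<delta>(1))
    fix s
    assume "dist s t < \<delta>"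
    have eq: "U s v - U t v = U s (v - y) + (U s y - U t y) - U t (v - y)"
      by (simp add: linear)
    have "norm (U s v - U t v) \<le> norm (U s (v - y)) + norm (U s y - U t y) + norm (U t (v - y))"
      unfolding eq by (meson add_mono norm_triangle_ineq norm_triangle_ineq4 order_refl order_trans)
    also have "\<dots> < \<epsilon>"
      using \<delta>(2)[OF \<open>dist s t < \<delta>\<close>] y(2)
      by (simp add: unitary_opD(3)[OF weight_flowD(1)[OF U]] dist_norm)
    finally show "dist (U s v) (U t v) < \<epsilon>"
      by (simp add: dist_norm)
  qed
qed

text \<open>Weight vectors are eigenvectors, and a linear left inverse would have to send 0 to a
  nonzero weight vector.\<close>

lemma weight_energy_in_spectrum:
  assumes U: "is_weight_flow e lam V act B U" and \<pi>: "\<And>t. \<pi> (id, t) = U t"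
    and \<mu>: "\<mu> \<in> weights V act"
  shows "complex_of_real (character e B (\<lambda>j. \<mu> j - lam j)) \<in> graph_spectrum (hamiltonian \<pi>)"
proof -
  let ?\<eta> = "character e B (\<lambda>j. \<mu> j - lam j)"
  obtain v where v: "v \<in> weight_space V act \<mu>" "v \<noteq> 0"
    using \<mu> by (auto simp: weights_def)
  have mem: "(v, complex_of_real ?\<eta> *\<^sub>C v) \<in> hamiltonian \<pi>"
    using has_vector_derivative_cis[of ?\<eta> v]
    by (simp add: hamiltonian_def \<pi> weight_flowD(2)[OF U \<mu> v(1)])
  have "False" if R: "bounded_clinear R"
    "\<forall>(x, y)\<in>hamiltonian \<pi>. R (y - complex_of_real ?\<eta> *\<^sub>C x) = x" for R
  proof -
    have "R (complex_of_real ?\<eta> *\<^sub>C v - complex_of_real ?\<eta> *\<^sub>C v) = v"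
      using R(2) mem by blast
    with v(2) show False
      by (simp add: bounded_clinearD(4)[OF R(1)])
  qed
  then show ?thesis
    unfolding graph_spectrum_def mem_Collect_eq by blast
qed

text \<open>Unitarity moves the flow onto \<open>x\<close>, where it is a phase. Differentiating
  shows that the Hamiltonian acts componentwise on every vector of its domain, inside
  \<open>V\<close> or not.\<close>

lemma weight_flow_derivative:
  assumes U: "is_weight_flow e lam V act B U"
    and v: "((\<lambda>t. U t v) has_vector_derivative \<i> *\<^sub>C w) (at 0)"
    and \<mu>: "\<mu> \<in> weights V act" and x: "x \<in> weight_space V act \<mu>"
  shows "cinner x w = complex_of_real (character e B (\<lambda>j. \<mu> j - lam j)) * cinner x v"
proof -
  let ?\<eta> = "character e B (\<lambda>j. \<mu> j - lam j)"
  have "cinner x (U t v) = cis (t * ?\<eta>) * cinner x v" for t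
  proof -
    have "cinner x v = cinner (cis (t * ?\<eta>) *\<^sub>C x) (U t v)"
      using unitary_opD(2)[OF weight_flowD(1)[OF U], of t x v] weight_flowD(2)[OF U \<mu> x] by simp
    also have "\<dots> = cis (- (t * ?\<eta>)) * cinner x (U t v)"
      by (simp add: cinner_scaleC_left cis_cnj)
    finally show ?thesis
      by (simp add: cis_mult flip: mult.assoc)
  qed
  then have "((\<lambda>t. cis (t * ?\<eta>) * cinner x v) has_vector_derivative cinner x (\<i> *\<^sub>C w)) (at 0)"
    using bounded_linear.has_vector_derivative[OF bounded_linear_cinner_right v, of x] by simp
  moreover have "((\<lambda>t. cis (t * ?\<eta>) * cinner x v) has_vector_derivative
      \<i> * (complex_of_real ?\<eta> * cinner x v)) (at 0)"
    using bounded_linear.has_vector_derivative[OF bounded_linear_cinner_right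
        has_vector_derivative_cis[of ?\<eta> v], of x]
    by (simp add: cinner_scaleC_right mult.assoc)
  ultimately have "cinner x (\<i> *\<^sub>C w) = \<i> * (complex_of_real ?\<eta> * cinner x v)"
    by (rule vector_derivative_unique_at)
  then show ?thesis
    by (simp add: cinner_scaleC_right)
qed

text \<open>Approximating \<open>v\<close> by elements of \<open>V\<close> gives no control over \<open>w\<close>, so the resolvent at \<open>cnj z\<close> is
  applied to a test vector \<open>y \<in> V\<close> instead, where it is a finite sum over weights.\<close>

lemma weight_flow_resolvent_bound:
  assumes dense: "closure V = UNIV" and U: "is_weight_flow e lam V act B U"
    and nonneg: "\<And>\<mu>. \<mu> \<in> weights V act \<Longrightarrow> 0 \<le> character e B (\<lambda>j. \<mu> j - lam j)"
    and v: "((\<lambda>t. U t v) has_vector_derivative \<i> *\<^sub>C w) (at 0)"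
    and z: "z \<noteq> 0" "Re z \<le> 0"
  shows "cmod z * norm v \<le> norm (w - z *\<^sub>C v)"
proof -
  let ?\<eta> = "\<lambda>\<mu>. character e B (\<lambda>j. \<mu> j - lam j)"
  have "cmod (cinner y v) * cmod z \<le> norm y * norm (w - z *\<^sub>C v)" if "y \<in> V" for y
  proof -
    obtain F f where F: "finite F" "F \<subseteq> weights V act"
      and f: "\<And>\<mu>. \<mu> \<in> F \<Longrightarrow> f \<mu> \<in> weight_space V act \<mu>" and y: "y = (\<Sum>\<mu>\<in>F. f \<mu>)"
      using \<open>y \<in> V\<close> by (rule weight_decomposition) blast
    \<comment> \<open>Eigenvalues of the resolvent at \<open>cnj z\<close>; energies are real, so
      conjugation affects \<open>z\<close> only.\<close>
    define c where "c \<mu> = 1 / cnj (complex_of_real (?\<eta> \<mu>) - z)" for \<mu>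
    \<comment> \<open>A point of the closed left half-plane is at least as far from any non-negative
      energy as from 0.\<close>
    have gap: "cmod z \<le> cmod (complex_of_real (?\<eta> \<mu>) - z)" if "\<mu> \<in> F" for \<mu>
    proof -
      have "(Re z)\<^sup>2 \<le> (?\<eta> \<mu> - Re z)\<^sup>2"
        using nonneg[of \<mu>] that F(2) z(2) by (intro power2_le_iff_abs_le[THEN iffD2]) auto
      then have "(cmod z)\<^sup>2 \<le> (cmod (complex_of_real (?\<eta> \<mu>) - z))\<^sup>2"
        by (simp add: cmod_power2)
      then show ?thesis
        by (rule power2_le_imp_le) simp
    qed
    then have nz: "complex_of_real (?\<eta> \<mu>) - z \<noteq> 0" if "\<mu> \<in> F" for \<mu>
      using z(1) that by fastforce
    let ?y = "\<Sum>\<mu>\<in>F. c \<mu> *\<^sub>C f \<mu>"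
    have "cinner ?y (w - z *\<^sub>C v) = (\<Sum>\<mu>\<in>F. cnj (c \<mu>) * cinner (f \<mu>) (w - z *\<^sub>C v))"
      by (simp add: cinner_sum_left cinner_scaleC_left)
    also have "\<dots> = (\<Sum>\<mu>\<in>F. cinner (f \<mu>) v)"
    proof (intro sum.cong refl)
      fix \<mu>
      assume \<mu>: "\<mu> \<in> F"
      have "cinner (f \<mu>) (w - z *\<^sub>C v) = (complex_of_real (?\<eta> \<mu>) - z) * cinner (f \<mu>) v"
        using weight_flow_derivative[OF U v subsetD[OF F(2) \<mu>] f[OF \<mu>]]
        by (simp add: cinner_diff_right cinner_scaleC_right left_diff_distrib)
      then show "cnj (c \<mu>) * cinner (f \<mu>) (w - z *\<^sub>C v) = cinner (f \<mu>) v"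
        using nz[OF \<mu>] by (simp add: c_def)
    qed
    finally have inner: "cinner ?y (w - z *\<^sub>C v) = cinner y v"
      by (simp add: y cinner_sum_left)
    have orth: "cinner (f \<mu>) (f \<nu>) = 0" if "\<mu> \<in> F" "\<nu> \<in> F" "\<mu> \<noteq> \<nu>" for \<mu> \<nu>
      using that f weight_spaces_orthogonal by blast
    have "(norm ?y * cmod z)\<^sup>2 = (\<Sum>\<mu>\<in>F. (cmod (c \<mu>) * cmod z)\<^sup>2 * (norm (f \<mu>))\<^sup>2)"
      using norm_orthogonal_sum[OF F(1), of "\<lambda>\<mu>. c \<mu> *\<^sub>C f \<mu>"] orth
      by (simp add: cinner_scaleC_left cinner_scaleC_right norm_scaleC power_mult_distrib
          sum_distrib_left sum_distrib_right mult_ac)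
    also have "\<dots> \<le> (\<Sum>\<mu>\<in>F. 1 * (norm (f \<mu>))\<^sup>2)"
    proof (intro sum_mono mult_right_mono zero_le_power2)
      fix \<mu>
      assume "\<mu> \<in> F"
      then have "cmod (c \<mu>) * cmod z \<le> 1"
        using gap nz by (simp add: c_def norm_divide divide_le_eq del: complex_cnj_diff)
      then show "(cmod (c \<mu>) * cmod z)\<^sup>2 \<le> 1"
        by (simp add: power_le_one)
    qed
    also have "\<dots> = (norm y)\<^sup>2"
      using norm_orthogonal_sum[OF F(1), of f] orth by (simp add: y)
    finally have le: "norm ?y * cmod z \<le> norm y"
      by (rule power2_le_imp_le) simp
    have "cmod (cinner y v) * cmod z \<le> norm ?y * norm (w - z *\<^sub>C v) * cmod z"
      unfolding inner[symmetric] by (intro mult_right_mono norm_cinner_le) simp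
    also have "\<dots> = (norm ?y * cmod z) * norm (w - z *\<^sub>C v)"
      by (simp add: mult_ac)
    also have "\<dots> \<le> norm y * norm (w - z *\<^sub>C v)"
      by (intro mult_right_mono le) simp
    finally show ?thesis .
  qed
  \<comment> \<open>The inequality is closed in \<open>y\<close>, so it extends from
    \<open>V\<close> to the whole space and can be read at \<open>y = v\<close>.\<close>
  then have "V \<subseteq> {y. cmod (cinner y v) * cmod z \<le> norm y * norm (w - z *\<^sub>C v)}"
    by blast
  moreover have "closed {y. cmod (cinner y v) * cmod z \<le> norm y * norm (w - z *\<^sub>C v)}"
    by (intro closed_Collect_le continuous_intros linear_continuous_on bounded_linear_cinner_left)
  ultimately have "closure V \<subseteq> {y. cmod (cinner y v) * cmod z \<le> norm y * norm (w - z *\<^sub>C v)}"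
    by (rule closure_minimal)
  then have "cmod (cinner v v) * cmod z \<le> norm v * norm (w - z *\<^sub>C v)"
    using dense by blast
  then have "norm v * (cmod z * norm v) \<le> norm v * norm (w - z *\<^sub>C v)"
    by (simp add: cinner_self norm_power power2_eq_square norm_mult mult_ac)
  then show ?thesis
    by (cases "v = 0") (simp_all add: mult_le_cancel_left)
qed

text \<open>Squaring the resolvent bound cancels the term in \<open>norm v\<close> and bounds
  \<open>Re (z * cinner w v)\<close> uniformly for \<open>z\<close> in the left half-plane. Letting
  \<open>z\<close> go to infinity along the negative real axis gives the sign of the real part; both
  imaginary half-axes together remove the imaginary part.\<close>

lemma weight_flow_energy_nonneg:
  assumes dense: "closure V = UNIV" and U: "is_weight_flow e lam V act B U"
    and nonneg: "\<And>\<mu>. \<mu> \<in> weights V act \<Longrightarrow> 0 \<le> character e B (\<lambda>j. \<mu> j - lam j)"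
    and v: "((\<lambda>t. U t v) has_vector_derivative \<i> *\<^sub>C w) (at 0)"
  shows "cinner v w \<in> \<real>\<^sub>\<ge>\<^sub>0"
proof -
  have bound: "Re (z * cinner w v) \<le> (norm w)\<^sup>2 / 2" if "z \<noteq> 0" "Re z \<le> 0" for z
  proof -
    have "(norm (z *\<^sub>C v))\<^sup>2 \<le> (norm (w - z *\<^sub>C v))\<^sup>2"
      using weight_flow_resolvent_bound[OF assms that] by (simp add: norm_scaleC power_mono)
    then show ?thesis
      by (simp add: norm_diff_squared cinner_scaleC_right)
  qed
  have "- Re (cinner w v) \<le> 0"
    by (rule le_zero_if_multiples_bounded[of _ "(norm w)\<^sup>2 / 2"])
      (use bound[of "complex_of_real (- r)" for r] in force)
  moreover have "- Im (cinner w v) \<le> 0"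
    by (rule le_zero_if_multiples_bounded[of _ "(norm w)\<^sup>2 / 2"])
      (use bound[of "\<i> * complex_of_real r" for r] in force)
  moreover have "Im (cinner w v) \<le> 0"
    by (rule le_zero_if_multiples_bounded[of _ "(norm w)\<^sup>2 / 2"])
      (use bound[of "- \<i> * complex_of_real r" for r] in force)
  moreover have "cinner v w = cnj (cinner w v)"
    by (rule cinner_commute)
  ultimately show ?thesis
    by (simp add: complex_nonneg_Reals_iff)
qed

end

section \<open>Inner perturbation of the covariant representation\<close>

locale highest_weight_rep =
  onb_family e + unitary_highest_weight_module lam pos V act v\<^sub>0 + integrated_rep e V act d\<rho> \<rho>
  for e :: "'j \<Rightarrow> 'h::chilbert_space" and lam :: "'j \<Rightarrow> int" and pos :: "('j \<Rightarrow> int) set"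
    and V :: "'k::chilbert_space set" and act :: "('j \<Rightarrow> 'j \<Rightarrow> complex) \<Rightarrow> 'k \<Rightarrow> 'k"
    and v\<^sub>0 :: 'k and d\<rho> \<rho> :: "('h \<Rightarrow> 'h) \<Rightarrow> 'k \<Rightarrow> 'k" +
  assumes dense_V: "closure V = UNIV" and bounded_lam: "\<exists>C. \<forall>j. \<bar>lam j\<bar> \<le> C"
begin

text \<open>With finitely many entries the operator comes from a skew-hermitian finite matrix, on
  which \<open>d\<rho>\<close> is known to be \<open>act\<close>.\<close>

lemma derived_diag_finite:
  assumes F: "finite F" "\<And>j. j \<notin> F \<Longrightarrow> s j = 0" and v: "v \<in> weight_space V act \<mu>"
  shows "d\<rho> (diag_op e (\<lambda>j. \<i> * complex_of_real (s j))) v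
    = (\<Sum>j\<in>F. (\<i> * complex_of_real (of_int (\<mu> j) * s j)) *\<^sub>C v)"
proof -
  let ?X = "\<lambda>j k. of_bool (j = k) * (\<i> * complex_of_real (s j))"
  let ?I = "(\<lambda>j. (j, j)) ` F"
  have I: "finite ?I" "{(j, k). ?X j k \<noteq> 0} \<subseteq> ?I"
    using F by auto
  have inj: "inj_on (\<lambda>j. (j, j)) F"
    by (simp add: inj_on_def)
  have "?X \<in> gl"
    unfolding gl_def mem_Collect_eq by (rule finite_subset[OF I(2,1)])
  moreover have "mat_adj ?X = (\<lambda>j k. - ?X j k)"
    by (auto simp: mat_adj_def fun_eq_iff)
  ultimately have "d\<rho> (mat_op e ?X) v = act ?X v"
    by (rule derived_extends[OF _ _ weight_spaceD(1)[OF v]])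
  also have "act ?X v = (\<Sum>(j, k)\<in>?I. ?X j k *\<^sub>C act (matrix_unit j k) v)"
    by (rule act_eq_sum_units[OF I(1) _ weight_spaceD(1)[OF v]]) (use I(2) in blast)
  also have "\<dots> = (\<Sum>j\<in>F. (\<i> * complex_of_real (of_int (\<mu> j) * s j)) *\<^sub>C v)"
    by (simp add: sum.reindex[OF inj] weight_spaceD(2)[OF v] scaleC_scaleC mult_ac)
  also have "mat_op e ?X = diag_op e (\<lambda>j. \<i> * complex_of_real (s j))"
  proof
    fix x
    have "mat_op e ?X x = (\<Sum>(j, k)\<in>?I. (?X j k * cinner (e k) x) *\<^sub>C e j)"
      unfolding mat_op_def by (rule sum.mono_neutral_left[OF I]) auto
    also have "\<dots> = diag_op e (\<lambda>j. \<i> * complex_of_real (s j)) x"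
      by (subst diag_op_finite[OF F(1)]) (simp_all add: F(2) sum.reindex[OF inj])
    finally show "mat_op e ?X x = diag_op e (\<lambda>j. \<i> * complex_of_real (s j)) x" .
  qed
  finally show ?thesis .
qed

text \<open>The first series converges because \<open>lam\<close> is bounded, the second is finite
  because a weight differs from \<open>lam\<close> at finitely many indices. The split isolates the
  part common to all weights, which a scalar phase can cancel.\<close>

lemma weight_has_sum:
  fixes s :: "'j \<Rightarrow> real"
  assumes s: "s abs_summable_on UNIV" and \<mu>: "\<mu> \<in> weights V act"
  shows "((\<lambda>j. of_int (\<mu> j) * s j) has_sum
    ((\<Sum>\<^sub>\<infinity>j. of_int (lam j) * s j) + (\<Sum>j | \<mu> j - lam j \<noteq> 0. of_int (\<mu> j - lam j) * s j))) UNIV"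
proof -
  obtain C where C: "\<And>j. \<bar>lam j\<bar> \<le> C"
    using bounded_lam by blast
  have "(\<lambda>j. of_int (lam j) * s j) abs_summable_on UNIV"
  proof (rule Infinite_Sum.abs_summable_on_comparison_test)
    show "(\<lambda>j. of_int C * s j) abs_summable_on UNIV"
      using summable_on_cmult_right[OF s, of "\<bar>of_int C\<bar>"] by (simp add: abs_mult)
    have "\<bar>real_of_int (lam j)\<bar> \<le> \<bar>real_of_int C\<bar>" for j
      using C[of j] by linarith
    then show "norm (of_int (lam j) * s j) \<le> norm (of_int C * s j)" for j
      by (simp add: abs_mult mult_right_mono)
  qed
  then have "((\<lambda>j. of_int (lam j) * s j) has_sum (\<Sum>\<^sub>\<infinity>j. of_int (lam j) * s j)) UNIV"
    by (intro has_sum_infsum) (rule abs_summable_summable)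
  moreover have "((\<lambda>j. of_int (\<mu> j - lam j) * s j) has_sum
      (\<Sum>j | \<mu> j - lam j \<noteq> 0. of_int (\<mu> j - lam j) * s j)) UNIV"
    by (rule has_sum_finite_neutralI[of "{j. \<mu> j - lam j \<noteq> 0}"])
      (use weights_finite_support[OF \<mu>] in auto)
  ultimately show ?thesis
    using has_sum_add by (fastforce simp: left_diff_distrib)
qed

text \<open>Truncating \<open>s\<close> to finitely many entries changes the operator by little in trace norm, so
  the finite case and the continuity of \<open>d\<rho>\<close> suffice.\<close>

lemma derived_diag:
  assumes s: "s abs_summable_on UNIV" and \<mu>: "\<mu> \<in> weights V act"
    and v: "v \<in> weight_space V act \<mu>"
  shows "d\<rho> (diag_op e (\<lambda>j. \<i> * complex_of_real (s j))) v
    = (\<i> * complex_of_real (\<Sum>\<^sub>\<infinity>j. of_int (\<mu> j) * s j)) *\<^sub>C v"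
proof -
  let ?D = "\<lambda>s. diag_op e (\<lambda>j. \<i> * complex_of_real (s j))"
  let ?f = "\<lambda>j. (\<i> * complex_of_real (of_int (\<mu> j) * s j)) *\<^sub>C v"
  obtain C where C: "\<And>x. x \<in> u1 \<Longrightarrow> onorm (d\<rho> x) \<le> C * trace_norm x"
    using derived_continuous by blast
  define T where "T = (\<Sum>\<^sub>\<infinity>j. \<bar>s j\<bar>)"
  have abs_s: "(\<lambda>j. \<bar>s j\<bar>) summable_on UNIV"
    using s by simp
  have approx: "norm (sum ?f F - d\<rho> (?D s) v) \<le> \<bar>C\<bar> * (T - (\<Sum>j\<in>F. \<bar>s j\<bar>)) * norm v"
    if F: "finite F" for F
  proof -
    define s1 where "s1 j = (if j \<in> F then s j else 0)" for j
    define s2 where "s2 j = (if j \<in> F then 0 else s j)" for j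
    have s1: "s1 abs_summable_on UNIV" and s2: "s2 abs_summable_on UNIV"
      by (rule Infinite_Sum.abs_summable_on_comparison_test[OF s], simp add: s1_def s2_def)+
    have i: "(\<lambda>j. \<i> * complex_of_real (r j)) abs_summable_on UNIV" if "r abs_summable_on UNIV" for r
      using that by (simp add: norm_mult)
    have "?D s = (\<lambda>z. ?D s1 z + ?D s2 z)"
      by (rule eq_on_basis)
        (simp_all add: bounded_clinear_add bounded_clinear_diag_op[OF i[OF s]]
          bounded_clinear_diag_op[OF i[OF s1]] bounded_clinear_diag_op[OF i[OF s2]] diag_op_basis,
          simp add: s1_def s2_def)
    then have "d\<rho> (?D s) v = d\<rho> (?D s1) v + d\<rho> (?D s2) v"
      using derived_add[OF diag_op_mem_u1[OF s1] diag_op_mem_u1[OF s2]] by simp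
    moreover have "d\<rho> (?D s1) v = sum ?f F"
      by (subst derived_diag_finite[OF F _ v]) (simp_all add: s1_def)
    ultimately have "norm (sum ?f F - d\<rho> (?D s) v) = norm (d\<rho> (?D s2) v)"
      by simp
    also have "\<dots> \<le> onorm (d\<rho> (?D s2)) * norm v"
      using derived_skew[OF diag_op_mem_u1[OF s2]]
      by (intro onorm) (simp add: bounded_skewhermitian_def bounded_clinear_def)
    also have "\<dots> \<le> (\<bar>C\<bar> * (\<Sum>\<^sub>\<infinity>j. \<bar>s2 j\<bar>)) * norm v"
    proof (rule mult_right_mono)
      have "onorm (d\<rho> (?D s2)) \<le> C * (\<Sum>\<^sub>\<infinity>j. \<bar>s2 j\<bar>)"
        using C[OF diag_op_mem_u1[OF s2]] by (simp add: trace_norm_diag_op[OF i[OF s2]] norm_mult)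
      also have "\<dots> \<le> \<bar>C\<bar> * (\<Sum>\<^sub>\<infinity>j. \<bar>s2 j\<bar>)"
        by (intro mult_right_mono infsum_nonneg) auto
      finally show "onorm (d\<rho> (?D s2)) \<le> \<bar>C\<bar> * (\<Sum>\<^sub>\<infinity>j. \<bar>s2 j\<bar>)" .
    qed simp
    also have "(\<Sum>\<^sub>\<infinity>j. \<bar>s2 j\<bar>) = T - (\<Sum>j\<in>F. \<bar>s j\<bar>)"
    proof -
      have "T = (\<Sum>\<^sub>\<infinity>j. \<bar>s1 j\<bar> + \<bar>s2 j\<bar>)"
        unfolding T_def by (intro infsum_cong) (simp add: s1_def s2_def)
      also have "\<dots> = (\<Sum>\<^sub>\<infinity>j. \<bar>s1 j\<bar>) + (\<Sum>\<^sub>\<infinity>j. \<bar>s2 j\<bar>)"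
        using s1 s2 by (intro infsum_add) simp_all
      also have "(\<Sum>\<^sub>\<infinity>j. \<bar>s1 j\<bar>) = (\<Sum>j\<in>F. \<bar>s j\<bar>)"
        by (intro infsumI has_sum_finite_neutralI[OF F]) (auto simp: s1_def)
      finally show ?thesis by simp
    qed
    finally show ?thesis .
  qed
  \<comment> \<open>The error is the tail of an absolutely convergent sum. Convergence along finite
    sets is what \<open>has_sum\<close> means, so uniqueness of sums identifies the limit.\<close>
  have "((\<lambda>F. \<Sum>j\<in>F. \<bar>s j\<bar>) \<longlongrightarrow> T) (finite_subsets_at_top UNIV)"
    unfolding T_def by (rule infsum_tendsto[OF abs_s])
  then have "((\<lambda>F. \<bar>C\<bar> * (T - (\<Sum>j\<in>F. \<bar>s j\<bar>)) * norm v) \<longlongrightarrow> \<bar>C\<bar> * (T - T) * norm v)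
      (finite_subsets_at_top UNIV)"
    by (intro tendsto_mult tendsto_diff tendsto_const)
  then have "((\<lambda>F. sum ?f F - d\<rho> (?D s) v) \<longlongrightarrow> 0) (finite_subsets_at_top UNIV)"
    by (intro Lim_null_comparison[OF eventually_finite_subsets_at_top_weakI[OF approx]]) simp_all
  then have "(?f has_sum d\<rho> (?D s) v) UNIV"
    unfolding has_sum_def by (rule LIM_zero_cancel)
  moreover have "(?f has_sum (\<i> * complex_of_real (\<Sum>\<^sub>\<infinity>j. of_int (\<mu> j) * s j)) *\<^sub>C v) UNIV"
  proof -
    have "((\<lambda>j. of_int (\<mu> j) * s j) has_sum (\<Sum>\<^sub>\<infinity>j. of_int (\<mu> j) * s j)) UNIV"
      using weight_has_sum[OF s \<mu>] by (simp add: has_sum_iff)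
    from has_sum_bounded_linear[OF bounded_linear_scaleC_left
        has_sum_cmult_right[OF has_sum_of_real[OF this, where 'a = complex], of \<i>]]
    show ?thesis .
  qed
  ultimately show ?thesis
    by (rule has_sum_unique)
qed

text \<open>\<open>\<rho>\<close> turns the exponential on \<open>U1\<close> into the exponential of
  \<open>d\<rho>\<close>, for which a weight vector is an eigenvector.\<close>

lemma rho_flow_diag:
  assumes s: "s abs_summable_on UNIV" and \<mu>: "\<mu> \<in> weights V act"
    and v: "v \<in> weight_space V act \<mu>"
  shows "\<rho> (flow (diag_op e (\<lambda>j. complex_of_real (s j))) t) v
    = cis (t * (\<Sum>\<^sub>\<infinity>j. of_int (\<mu> j) * s j)) *\<^sub>C v"
proof -
  have ts: "(\<lambda>j. t * s j) abs_summable_on UNIV"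
    using summable_on_cmult_right[OF s, of "\<bar>t\<bar>"] by (simp add: abs_mult)
  let ?X = "diag_op e (\<lambda>j. \<i> * complex_of_real (t * s j))"
  have "(\<lambda>x. (\<i> * of_real t) *\<^sub>C diag_op e (\<lambda>j. complex_of_real (s j)) x) = ?X"
  proof (rule eq_on_basis)
    show "bounded_clinear (\<lambda>x. (\<i> * of_real t) *\<^sub>C diag_op e (\<lambda>j. complex_of_real (s j)) x)"
      by (rule bounded_clinear_scaleC[OF bounded_clinear_diag_op]) (use s in simp)
    show "bounded_clinear ?X"
      by (rule bounded_clinear_diag_op) (use ts in \<open>simp add: norm_mult abs_mult\<close>)
  qed (simp add: diag_op_basis scaleC_scaleC mult.assoc)
  then have "\<rho> (flow (diag_op e (\<lambda>j. complex_of_real (s j))) t) v = op_exp (d\<rho> ?X) v"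
    by (simp only: flow_def exponentiates[OF diag_op_mem_u1[OF ts]])
  also have "\<dots> = exp (\<i> * complex_of_real (\<Sum>\<^sub>\<infinity>j. of_int (\<mu> j) * (t * s j))) *\<^sub>C v"
    using derived_skew[OF diag_op_mem_u1[OF ts]]
    by (intro op_exp_eigenvector derived_diag[OF ts \<mu> v])
      (simp add: bounded_skewhermitian_def bounded_clinear_def)
  also have "(\<Sum>\<^sub>\<infinity>j. of_int (\<mu> j) * (t * s j)) = t * (\<Sum>\<^sub>\<infinity>j. of_int (\<mu> j) * s j)"
    by (simp add: mult.left_commute infsum_cmult_right')
  finally show ?thesis
    by (simp add: cis_conv_exp)
qed

section \<open>The perturbed flow and its covariance\<close>

lemma U1_group: "group (U1 :: ('h \<Rightarrow> 'h) monoid)"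
  by (rule group_hom.axioms(1)[OF rep])

lemma U1_mult: "g \<in> carrier U1 \<Longrightarrow> h \<in> carrier U1 \<Longrightarrow> g \<circ> h \<in> carrier U1"
  for g h :: "'h \<Rightarrow> 'h"
  using monoid.m_closed[OF group.is_monoid[OF U1_group], of g h] by (simp add: U1_def)

lemma U1_id: "(id :: 'h \<Rightarrow> 'h) \<in> carrier U1"
  using monoid.one_closed[OF group.is_monoid[OF U1_group]] by (simp add: U1_def)

lemma rho_unitary: "g \<in> carrier U1 \<Longrightarrow> unitary_op (\<rho> g)"
  using group_hom.hom_closed[OF rep] by (simp add: unitary_group_def)

lemma rho_mult: "g \<in> carrier U1 \<Longrightarrow> h \<in> carrier U1 \<Longrightarrow> \<rho> (g \<circ> h) = \<rho> g \<circ> \<rho> h"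
  using group_hom.hom_mult[OF rep, of g h] by (simp add: unitary_group_def U1_def)

lemma rho_id: "\<rho> id = id"
  using group_hom.hom_one[OF rep] by (simp add: unitary_group_def U1_def)

text \<open>The group element alone multiplies \<open>v\<^sub>0\<close> by a phase, while a weight
  flow must fix \<open>v\<^sub>0\<close>; the scalar factor undoes exactly this.\<close>

definition shifted_flow :: "('j \<Rightarrow> real) \<Rightarrow> (real \<Rightarrow> 'k \<Rightarrow> 'k) \<Rightarrow> real \<Rightarrow> 'k \<Rightarrow> 'k" where
  "shifted_flow s U t v = cis (t * (\<Sum>\<^sub>\<infinity>j. of_int (lam j) * s j)) *\<^sub>C
    \<rho> (flow (diag_op e (\<lambda>j. complex_of_real (s j))) (- t)) (U t v)"

lemma diag_entry_sub_diag_op: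
  "diag_entry e (\<lambda>x. B x - diag_op e (\<lambda>j. complex_of_real (s j)) x) j = diag_entry e B j - s j"
  by (simp add: diag_entry_def cinner_diff_right diag_op_basis cinner_scaleC_right cinner_e)

lemma shifted_flow_weight_flow:
  assumes s: "s abs_summable_on UNIV" and U: "is_weight_flow e lam V act B U"
  shows "is_weight_flow e lam V act (\<lambda>x. B x - diag_op e (\<lambda>j. complex_of_real (s j)) x)
    (shifted_flow s U)"
  unfolding is_weight_flow_def
proof (intro conjI allI ballI)
  fix t
  let ?g = "flow (diag_op e (\<lambda>j. complex_of_real (s j))) (- t)"
  show "unitary_op (shifted_flow s U t)"
    unfolding shifted_flow_def[abs_def]
    by (intro unitary_op_phase unitary_op_compose[of "\<rho> ?g" "U t"] rho_unitary flow_mem_U1 s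
        weight_flowD(1)[OF U])
  fix \<mu> v
  assume \<mu>: "\<mu> \<in> weights V act" and v: "v \<in> weight_space V act \<mu>"
  define \<sigma> where "\<sigma> = (\<Sum>j | \<mu> j - lam j \<noteq> 0. of_int (\<mu> j - lam j) * s j)"
  define \<eta> where "\<eta> = character e B (\<lambda>j. \<mu> j - lam j)"
  define c where "c = (\<Sum>\<^sub>\<infinity>j. of_int (lam j) * s j)"
  have "character e (\<lambda>x. B x - diag_op e (\<lambda>j. complex_of_real (s j)) x) (\<lambda>j. \<mu> j - lam j)
      = \<eta> - \<sigma>"
    by (simp add: \<eta>_def \<sigma>_def character_def diag_entry_sub_diag_op right_diff_distrib sum_subtractf)
  moreover have "(\<Sum>\<^sub>\<infinity>j. of_int (\<mu> j) * s j) = c + \<sigma>"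
    unfolding c_def \<sigma>_def using weight_has_sum[OF s \<mu>] by (rule infsumI)
  moreover have "U t v = cis (t * \<eta>) *\<^sub>C v"
    unfolding \<eta>_def by (rule weight_flowD(2)[OF U \<mu> v])
  \<comment> \<open>The three phases are \<open>t * c\<close>, \<open>- t * (c + \<sigma>)\<close>
    and \<open>t * \<eta>\<close>, so the infinite sum \<open>c\<close> drops out.\<close>
  ultimately show "shifted_flow s U t v = cis (t *
      character e (\<lambda>x. B x - diag_op e (\<lambda>j. complex_of_real (s j)) x) (\<lambda>j. \<mu> j - lam j)) *\<^sub>C v"
    using unitary_opD(1)[OF rho_unitary[OF flow_mem_U1[OF s]], THEN bounded_clinearD(2), of "- t"]
    by (simp add: shifted_flow_def rho_flow_diag[OF s \<mu> v] scaleC_scaleC cis_mult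
        right_diff_distrib distrib_left flip: c_def)
qed

text \<open>The new action differs from the old one by inner automorphisms coming from
  \<open>flow S\<close>, which stays in \<open>U1\<close>. Each property is therefore transferred
  from \<open>\<pi>\<close> instead of being derived from the generators.\<close>

lemma covariant_rep_shifted:
  assumes A: "bounded_selfadjoint A" and d: "\<And>j. A (e j) = complex_of_real (d j) *\<^sub>C e j"
    and s: "s abs_summable_on UNIV" and U: "is_weight_flow e lam V act A U"
    and \<pi>: "\<And>g t. g \<in> carrier U1 \<Longrightarrow> \<pi> (g, t) = \<rho> g \<circ> U t"
    and cov: "covariant_rep (conj_action A) \<pi>"
  shows "covariant_rep (conj_action (\<lambda>x. A x - diag_op e (\<lambda>j. complex_of_real (s j)) x))
    (\<lambda>(g, t). \<rho> g \<circ> shifted_flow s U t)"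
proof -
  define S where "S = diag_op e (\<lambda>j. complex_of_real (s j))"
  define A' where "A' x = A x - S x" for x
  define U' where "U' = shifted_flow s U"
  define c where "c = (\<Sum>\<^sub>\<infinity>j. of_int (lam j) * s j)"
  have hom: "group_hom (semidirect U1 (conj_action A)) unitary_group \<pi>"
    using cov by (simp add: covariant_rep_def)
  have bA: "bounded_clinear A"
    using A by (simp add: bounded_selfadjoint_def)
  have bS: "bounded_clinear S"
    unfolding S_def by (rule bounded_clinear_diag_op) (use s in simp)
  have bA': "bounded_clinear A'"
    unfolding A'_def[abs_def] by (rule bounded_clinear_sub[OF bA bS])
  have Se: "S (e j) = complex_of_real (s j) *\<^sub>C e j" for j
    by (simp add: S_def diag_op_basis)
  have A'e: "A' (e j) = complex_of_real (d j - s j) *\<^sub>C e j" for j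
    by (simp add: A'_def d Se complex_vector.scale_left_diff_distrib)
  have U': "is_weight_flow e lam V act A' U'"
    using shifted_flow_weight_flow[OF s U] by (simp only: U'_def A'_def[abs_def] S_def)
  have flow_S: "flow S t \<in> carrier U1" for t
    unfolding S_def by (rule flow_mem_U1[OF s])
  have flow_A': "flow A' t = flow S (- t) \<circ> flow A t" "flow A' t = flow A t \<circ> flow S (- t)" for t
    using flow_compose[OF bS Se bA d bA' A'e, of "- t" t t]
      flow_compose[OF bA d bS Se bA' A'e, of t "- t" t] by (simp_all add: algebra_simps)
  have flow_A'_add: "flow A' (t + u) = flow A' t \<circ> flow A' u" for t u
    using flow_compose[OF bA' A'e bA' A'e bA' A'e, of t u "t + u"] by (simp add: algebra_simps)
  have flow_A'_inverse: "flow A' t \<circ> flow A' (- t) = id" "flow A' (- t) \<circ> flow A' t = id" for t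
    using flow_A'_add[of t "- t"] flow_A'_add[of "- t" t] flow_zero[OF bA' A'e]
    by (simp_all only: add.right_inverse add.left_inverse)
  have flow_S_inverse: "flow S t \<circ> flow S (- t) = id" for t
    using flow_compose[OF bS Se bS Se bS Se, of t "- t" 0] flow_zero[OF bS Se]
    by (simp add: algebra_simps)
  \<comment> \<open>Read off from the semidirect product: \<open>conj_action A t h\<close> is the
    first component of the product of \<open>(id, t)\<close> and \<open>(h, 0)\<close>.\<close>
  have \<alpha>_closed: "conj_action A t h \<in> carrier U1" if "h \<in> carrier U1" for h t
  proof -
    have "group (semidirect U1 (conj_action A))"
      by (rule group_hom.axioms(1)[OF hom])
    from monoid.m_closed[OF group.is_monoid[OF this], of "(id, t)" "(h, 0)"] that U1_id
    show ?thesis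
      by (simp add: semidirect_def U1_def)
  qed
  have \<alpha>': "conj_action A' t h = flow S (- t) \<circ> conj_action A t h \<circ> flow S t" for t h
    using flow_A'(1)[of t] flow_A'(2)[of "- t"] by (simp add: conj_action_flow o_assoc)
  have \<alpha>'_closed: "conj_action A' t h \<in> carrier U1" if "h \<in> carrier U1" for h t
    unfolding \<alpha>' by (intro U1_mult flow_S \<alpha>_closed that)
  \<comment> \<open>Multiplicativity of \<open>\<pi>\<close> on the same product is the intertwining
    relation.\<close>
  have \<rho>\<alpha>: "\<rho> (conj_action A t h) (U t v) = U t (\<rho> h v)" if h: "h \<in> carrier U1" for h t v
  proof -
    have "\<pi> ((id, t) \<otimes>\<^bsub>semidirect U1 (conj_action A)\<^esub> (h, 0))
        = \<pi> (id, t) \<otimes>\<^bsub>unitary_group\<^esub> \<pi> (h, 0)"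
      by (rule group_hom.hom_mult[OF hom]) (use h U1_id in \<open>simp_all add: semidirect_def\<close>)
    then have "\<pi> (conj_action A t h, t) = \<pi> (id, t) \<circ> \<pi> (h, 0)"
      by (simp add: semidirect_def unitary_group_def U1_def)
    then have "\<rho> (conj_action A t h) \<circ> U t = \<rho> id \<circ> U t \<circ> (\<rho> h \<circ> U 0)"
      by (simp add: \<pi> \<alpha>_closed h U1_id)
    then have "\<rho> (conj_action A t h) \<circ> U t = U t \<circ> \<rho> h"
      by (simp add: rho_id weight_flow_zero[OF dense_V U])
    then show ?thesis
      by (metis comp_apply)
  qed
  have U'_def': "U' t v = cis (t * c) *\<^sub>C \<rho> (flow S (- t)) (U t v)" for t v
    by (simp add: U'_def shifted_flow_def c_def S_def)
  have \<rho>\<alpha>': "\<rho> (conj_action A' t h) (U' t v) = U' t (\<rho> h v)" if h: "h \<in> carrier U1" for h t v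
  proof -
    \<comment> \<open>The outer factor of the inner automorphism cancels against the one inside
      \<open>U'\<close>, leaving the unperturbed relation.\<close>
    have "\<rho> (flow S t) (\<rho> (flow S (- t)) x) = x" for x
      using rho_mult[OF flow_S flow_S, of t "- t"] by (simp add: flow_S_inverse rho_id fun_eq_iff)
    moreover have "\<rho> (conj_action A' t h) = \<rho> (flow S (- t)) \<circ> \<rho> (conj_action A t h) \<circ> \<rho> (flow S t)"
      unfolding \<alpha>' by (simp add: rho_mult U1_mult flow_S \<alpha>_closed h)
    ultimately show ?thesis
      using unitary_opD(1)[OF rho_unitary[OF \<alpha>'_closed[OF h]], THEN bounded_clinearD(2), of t]
      by (simp add: U'_def' \<rho>\<alpha>[OF h])
  qed
  let ?\<pi> = "\<lambda>(g, t). \<rho> g \<circ> U' t"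
  have "group_hom (semidirect U1 (conj_action A')) unitary_group ?\<pi>"
  proof (intro group_hom.intro group_hom_axioms.intro)
    show "group (semidirect U1 (conj_action A'))"
    proof (rule group_semidirect[OF U1_group \<alpha>'_closed])
      show "conj_action A' t (h \<otimes>\<^bsub>U1\<^esub> k) = conj_action A' t h \<otimes>\<^bsub>U1\<^esub> conj_action A' t k" for t h k
      proof -
        have "flow A' (- t) (flow A' t x) = x" for x
          using fun_cong[OF flow_A'_inverse(2), where x = x] by simp
        then show ?thesis
          by (simp add: conj_action_flow U1_def fun_eq_iff)
      qed
      show "conj_action A' t \<one>\<^bsub>U1\<^esub> = \<one>\<^bsub>U1\<^esub>" for t
        by (simp add: conj_action_flow U1_def flow_A'_inverse)
      show "conj_action A' 0 h = h" for h
        by (simp add: conj_action_flow flow_zero[OF bA' A'e])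
      show "conj_action A' (t + u) h = conj_action A' t (conj_action A' u h)" for t u h
      proof -
        \<comment> \<open>The summands are reversed because the right-hand factor of a conjugation
          composes in the opposite order.\<close>
        have "- (t + u) = - u + - t"
          by simp
        then show ?thesis
          by (simp only: conj_action_flow flow_A'_add o_assoc)
      qed
    qed
    show "group (unitary_group :: ('k \<Rightarrow> 'k) monoid)"
      by (rule group_hom.axioms(2)[OF rep])
    show "?\<pi> \<in> hom (semidirect U1 (conj_action A')) unitary_group"
    proof (rule homI)
      fix x y
      assume xy: "x \<in> carrier (semidirect U1 (conj_action A'))"
        "y \<in> carrier (semidirect U1 (conj_action A'))"
      obtain g t h u where eq: "x = (g, t)" "y = (h, u)" and g: "g \<in> carrier U1"
        and h: "h \<in> carrier U1"
        using xy by (cases x, cases y) (auto simp: semidirect_def)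
      show "?\<pi> x \<in> carrier unitary_group"
        using unitary_op_compose[OF rho_unitary[OF g] weight_flowD(1)[OF U', of t]]
        by (simp add: eq unitary_group_def o_def)
      have "\<rho> (g \<circ> conj_action A' t h) (U' (t + u) v) = \<rho> g (U' t (\<rho> h (U' u v)))" for v
        by (simp add: rho_mult[OF g \<alpha>'_closed[OF h]] weight_flow_add[OF dense_V U'] \<rho>\<alpha>'[OF h])
      then show "?\<pi> (x \<otimes>\<^bsub>semidirect U1 (conj_action A')\<^esub> y) = ?\<pi> x \<otimes>\<^bsub>unitary_group\<^esub> ?\<pi> y"
        by (simp add: eq semidirect_def unitary_group_def U1_def fun_eq_iff)
    qed
  qed
  moreover have "\<exists>\<delta>>0. \<forall>h\<in>carrier U1. \<forall>u. trace_norm (\<lambda>x. h x - g x) < \<delta> \<and> \<bar>u - t\<bar> < \<delta> \<longrightarrow>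
      norm (?\<pi> (h, u) v - ?\<pi> (g, t) v) < \<epsilon>" if g: "g \<in> carrier U1" and "\<epsilon> > 0" for v g t \<epsilon>
  proof -
    \<comment> \<open>At time 0 the flow \<open>U\<close> is the identity, so continuity of
      \<open>\<pi>\<close> there is continuity of \<open>\<rho>\<close> at \<open>g\<close>, applied
      to the fixed vector \<open>U' t v\<close>. The time variable is handled separately, as
      \<open>\<rho> h\<close> is isometric.\<close>
    have "\<exists>\<delta>>0. \<forall>h\<in>carrier U1. \<forall>u. trace_norm (\<lambda>x. h x - g x) < \<delta> \<and> \<bar>u - 0\<bar> < \<delta> \<longrightarrow>
        norm (\<pi> (h, u) (U' t v) - \<pi> (g, 0) (U' t v)) < \<epsilon> / 2"
      using cov g \<open>\<epsilon> > 0\<close> unfolding covariant_rep_def by (meson half_gt_zero)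
    then obtain \<delta>1 where \<delta>1: "\<delta>1 > 0" "\<And>h u. h \<in> carrier U1 \<Longrightarrow>
        trace_norm (\<lambda>x. h x - g x) < \<delta>1 \<Longrightarrow> \<bar>u\<bar> < \<delta>1 \<Longrightarrow>
        norm (\<pi> (h, u) (U' t v) - \<pi> (g, 0) (U' t v)) < \<epsilon> / 2"
      by auto
    obtain \<delta>2 where \<delta>2: "\<delta>2 > 0" "\<And>u. \<bar>u - t\<bar> < \<delta>2 \<Longrightarrow> norm (U' u v - U' t v) < \<epsilon> / 2"
      using weight_flow_continuous[OF dense_V U', where v = v and t = t] \<open>\<epsilon> > 0\<close>
      unfolding continuous_at_eps_delta dist_norm real_norm_def by (meson half_gt_zero)
    show ?thesis
    proof (intro exI[of _ "min \<delta>1 \<delta>2"] conjI ballI allI impI)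
      fix h u
      assume h: "h \<in> carrier U1"
        and near: "trace_norm (\<lambda>x. h x - g x) < min \<delta>1 \<delta>2 \<and> \<bar>u - t\<bar> < min \<delta>1 \<delta>2"
      note \<rho>h = unitary_opD[OF rho_unitary[OF h]]
      have "norm (\<rho> h (U' t v) - \<rho> g (U' t v)) < \<epsilon> / 2"
        using \<delta>1(2)[OF h, of 0] near \<delta>1(1) by (simp add: \<pi> g h weight_flow_zero[OF dense_V U])
      moreover have "norm (\<rho> h (U' u v) - \<rho> h (U' t v)) < \<epsilon> / 2"
        using \<delta>2(2)[of u] near by (simp add: \<rho>h(3) flip: bounded_clinearD(5)[OF \<rho>h(1)])
      ultimately show "norm (?\<pi> (h, u) v - ?\<pi> (g, t) v) < \<epsilon>"
        using norm_triangle_ineq[of "\<rho> h (U' u v) - \<rho> h (U' t v)" "\<rho> h (U' t v) - \<rho> g (U' t v)"]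
        by simp
    qed (use \<delta>1(1) \<delta>2(1) in simp)
  qed
  ultimately have "covariant_rep (conj_action A') ?\<pi>"
    unfolding covariant_rep_def by blast
  then show ?thesis
    by (simp only: A'_def[abs_def] S_def U'_def)
qed

end

theorem corollary2:
  fixes A :: "'h::chilbert_space \<Rightarrow> 'h"
    and e :: "'j \<Rightarrow> 'h"
    and lam :: "'j \<Rightarrow> int"
    and pos :: "('j \<Rightarrow> int) set"
    and V :: "'k::chilbert_space set"
    and act :: "('j \<Rightarrow> 'j \<Rightarrow> complex) \<Rightarrow> 'k \<Rightarrow> 'k"
    and v\<^sub>0 :: 'k
    and d\<rho> \<rho> :: "('h \<Rightarrow> 'h) \<Rightarrow> 'k \<Rightarrow> 'k"
    and \<pi> :: "('h \<Rightarrow> 'h) \<times> real \<Rightarrow> 'k \<Rightarrow> 'k"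
  assumes "infinite_dimensional TYPE('h)"
    and "bounded_selfadjoint A"
    and "inj e" and "orthonormal_basis (range e)" and "diagonal_in e A"
    and "\<exists>C. \<forall>j. \<bar>lam j\<bar> \<le> C"
    and "unitary_highest_weight_module lam pos V act v\<^sub>0"
    and "closure V = UNIV"
    and "integrated_rep e V act d\<rho> \<rho>"
    and "associated_rep e lam V act \<rho> A \<pi>"
    and "positive_energy_rep A \<pi>"
  shows "\<exists>A\<^sub>m\<^sub>i\<^sub>n \<pi>\<^sub>m\<^sub>i\<^sub>n. similar_reps e lam V act \<rho> A \<pi> A\<^sub>m\<^sub>i\<^sub>n \<pi>\<^sub>m\<^sub>i\<^sub>n \<and>
           minimal_energy_rep A\<^sub>m\<^sub>i\<^sub>n v\<^sub>0 \<pi>\<^sub>m\<^sub>i\<^sub>n"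
proof -
  interpret highest_weight_rep e lam pos V act v\<^sub>0 d\<rho> \<rho>
    using assms by (intro highest_weight_rep.intro onb_family.intro highest_weight_rep_axioms.intro)
  define d where "d = diag_entry e A"
  have A: "bounded_clinear A"
    using assms(2) by (simp add: bounded_selfadjoint_def)
  have Ae: "A (e j) = complex_of_real (d j) *\<^sub>C e j" for j
    using assms(5) by (auto simp: diagonal_in_def d_def diag_entry_def cinner_scaleC_right cinner_e)
  have d_bound: "\<bar>d j\<bar> \<le> onorm A" for j
    using onorm[OF bounded_clinearD(1)[OF A], of "e j"] by (simp add: Ae norm_scaleC)
  obtain U where U: "is_weight_flow e lam V act A U"
    and \<pi>: "\<And>g t. g \<in> carrier U1 \<Longrightarrow> \<pi> (g, t) = \<rho> g \<circ> U t"
    using assms(10) by (auto simp: associated_rep_def)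
  obtain m where m: "\<And>z. z \<in> graph_spectrum (hamiltonian \<pi>) \<Longrightarrow> m \<le> Re z"
    using assms(11) by (auto simp: positive_energy_rep_def)
  have energy: "m \<le> character e A (\<lambda>j. \<mu> j - lam j)" if "\<mu> \<in> weights V act" for \<mu>
    using m[OF weight_energy_in_spectrum[OF U _ that]] by (simp add: \<pi> U1_id rho_id)
  \<comment> \<open>Weight energies belong to the spectrum, so the lower bound \<open>m\<close>
    applies to exchanged weights of every size.\<close>
  have exchange: "sum d G - sum d F \<le> - m" if "finite F" "finite G" "card F = card G"
    "\<And>k j. k \<in> F \<Longrightarrow> j \<in> G \<Longrightarrow> lam k < lam j" for F G
    using energy[OF weight_exchange[OF that]] character_exchange[OF that(1,2,4), of e A]
    by (simp add: d_def)
  obtain N where N: "\<And>j. \<bar>lam j\<bar> \<le> N"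
    using assms(6) by blast
  obtain a where a: "\<And>j k. lam k < lam j \<Longrightarrow> a j \<le> a k" "(\<lambda>j. \<bar>d j - a j\<bar>) summable_on UNIV"
    using antitone_summable_approximation[of lam d "- m" "onorm A" N] exchange d_bound N by metis
  define s where "s j = d j - a j" for j
  have s: "s abs_summable_on UNIV"
    using a(2) by (simp add: s_def)
  define S where "S = diag_op e (\<lambda>j. complex_of_real (s j))"
  define A' where "A' x = A x - S x" for x
  define U' where "U' = shifted_flow s U"
  define \<pi>' where "\<pi>' = (\<lambda>(g, t). \<rho> g \<circ> U' t)"
  have S: "bounded_selfadjoint S" "diagonal_in e S"
    using bounded_selfadjoint_diag_op[OF s] by (auto simp: S_def diagonal_in_def diag_op_basis)
  have "(\<lambda>x. \<i> *\<^sub>C S x) = diag_op e (\<lambda>j. \<i> * complex_of_real (s j))"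
    by (rule eq_on_basis)
      (use s S in \<open>simp_all add: bounded_clinear_scaleC bounded_selfadjoint_def norm_mult
        bounded_clinear_diag_op diag_op_basis S_def scaleC_scaleC\<close>)
  then have iS: "(\<lambda>x. \<i> *\<^sub>C S x) \<in> u1"
    using diag_op_mem_u1[OF s] by simp
  have U': "is_weight_flow e lam V act A' U'"
    using shifted_flow_weight_flow[OF s U] by (simp only: U'_def A'_def[abs_def] S_def)
  have cov: "covariant_rep (conj_action A') \<pi>'"
    using covariant_rep_shifted[OF assms(2) Ae s U \<pi>] assms(11)
    by (simp only: positive_energy_rep_def A'_def[abs_def] S_def \<pi>'_def U'_def simp_thms)
  have "bounded_selfadjoint A'"
    unfolding A'_def[abs_def] by (rule bounded_selfadjoint_sub[OF assms(2) S(1)])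
  moreover have "A' (e j) = complex_of_real (a j) *\<^sub>C e j" for j
    by (simp add: A'_def S_def diag_op_basis Ae s_def complex_vector.scale_left_diff_distrib)
  then have "diagonal_in e A'"
    by (auto simp: diagonal_in_def)
  ultimately have "associated_rep e lam V act \<rho> A' \<pi>'"
    using U' by (auto simp: associated_rep_def \<pi>'_def)
  then have "similar_reps e lam V act \<rho> A \<pi> A' \<pi>'"
    using assms(10) S iS by (auto simp: similar_reps_def A'_def)
  moreover have \<pi>'_id: "\<pi>' (id, t) = U' t" for t
    by (simp add: \<pi>'_def rho_id)
  have "diag_entry e A' j = a j" for j
    using diag_entry_sub_diag_op[of A s j]
    by (simp add: A'_def[abs_def] S_def s_def flip: d_def)
  then have nonneg: "0 \<le> character e A' (\<lambda>j. \<mu> j - lam j)" if "\<mu> \<in> weights V act" for \<mu>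
    using that a(1) by (intro character_weights_nonneg) simp_all
  have "minimal_energy_rep A' v\<^sub>0 \<pi>'"
    unfolding minimal_energy_rep_def
  proof (intro conjI cov)
    show "\<forall>(v, w)\<in>hamiltonian \<pi>'. cinner v w \<in> \<real>\<^sub>\<ge>\<^sub>0"
      using weight_flow_energy_nonneg[OF dense_V U' nonneg] by (auto simp: hamiltonian_def \<pi>'_id)
    \<comment> \<open>At weight \<open>lam\<close> the character is an empty sum, so the new flow
      fixes \<open>v\<^sub>0\<close> and its orbit has derivative 0.\<close>
    have "lam \<in> weights V act"
      using hw_weight_space hw_nonzero by (auto simp: weights_def)
    then show "(v\<^sub>0, 0) \<in> hamiltonian \<pi>'"
      using weight_flowD(2)[OF U' _ hw_weight_space]
      by (simp add: hamiltonian_def \<pi>'_id character_def)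
  qed
  ultimately show ?thesis
    by blast
qed

end
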